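(* $\mathbb{T}/\mathrm{Rad}(\mathbb{T})\cong\bigoplus_{g=1}^{n_\sim}\mathrm{M}_{|\mathbb{D}(g)|}(\mathbb{F})$ as $\mathbb{F}$-algebras, where $\mathrm{Rad}(\mathbb{T})$ is the Jacobson radical of $\mathbb{T}$.
   Context: Let $\mathbb{F}$ be a field of characteristic $p\ge 0$; for a positive integer $m$, "$p\mid m$" means that the image of $m$ in $\mathbb{F}$ is zero. Let $n\ge 1$ and let $U_1,\dots,U_n$ be finite sets with $|U_h|\ge 2$. Put $X=U_1\times\cdots\times U_n$ and $E=\{0,1\}^n$. For $\mathbf g\in E$ let $S(\mathbf g)=\{a:\mathbf g_a=1\}$. For $V\subseteq\{1,\dots,n\}$ let $V^\circ=\{a\in V:|U_a|>2\}$. Let $R_{\mathbf g}=\{(\mathbf y,\mathbf z)\in X\times X:\ \mathbf y_a\neq\mathbf z_a\iff\mathbf g_a=1\}$ and $k_{\mathbf g}=\prod_{a\in S(\mathbf g)}(|U_a|-1)$ ($k_{\mathbf 0}=1$). Let $A_{\mathbf g}\in\mathrm{M}_X(\mathbb{F})$ be the $\{0,1\}$ adjacency matrix of $R_{\mathbf g}$. Fix $\mathbf x\in X$ and let $E^*_{\mathbf g}$ be the diagonal matrix with $(\mathbf y,\mathbf y)$-entry $1$ iff $(\mathbf x,\mathbf y)\in R_{\mathbf g}$, else $0$. $\mathbb{T}$ is the $\mathbb{F}$-subalgebra of $\mathrm{M}_X(\mathbb{F})$ generated by all $A_{\mathbf g},E^*_{\mathbf g}$. Let $\mathbb{P}$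 be the set of $(\mathbf a,\mathbf b,\mathbf c)\in E^3$ with $S(\mathbf a)\triangle S(\mathbf c)\subseteq S(\mathbf b)\subseteq(S(\mathbf a)\triangle S(\mathbf c))\cup(S(\mathbf a)\cap S(\mathbf c))^\circ$. Let $\mathbb{D}=\{(\mathbf a,\mathbf b,\mathbf c)\in\mathbb{P}: p\nmid k_{\mathbf b}\}$, and define an equivalence relation $\sim$ on $\mathbb{D}$ by $(\mathbf g,\mathbf h,\mathbf i)\sim(\mathbf j,\mathbf k,\mathbf l)$ iff $(S(\mathbf g)\cap S(\mathbf i))^\circ\setminus S(\mathbf h)=(S(\mathbf j)\cap S(\mathbf l))^\circ\setminus S(\mathbf k)$. Let $\mathbb{D}_1,\dots,\mathbb{D}_{n_\sim}$ be the distinct equivalence classes, and for $m\in\{1,\dots,n_\sim\}$ let $\mathbb{D}(m)=\{\mathbf a\in E:\ (\mathbf a,\mathbf b,\mathbf a)\in\mathbb{D}_m\text{ for some }\mathbf b\in E\}$. *)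

theory Defs
  imports "HOL-Algebra.QuotRing" "HOL-Algebra.Subrings" "HOL-Algebra.Module"
begin

section \<open>Algebras over a field\<close>

text \<open>
  An \<open>'f\<close>-algebra, for a field \<open>'f\<close>, is carried by the record \<^typ>\<open>('f, 'm) module\<close>, that is, a
  ring record together with a scalar multiplication. The library locale \<open>algebra\<close> cannot be used,
  because it only covers commutative algebras.
\<close>

definition subalg :: "'m set \<Rightarrow> ('f::field, 'm) module \<Rightarrow> bool" where
  "subalg B A \<longleftrightarrow> subring B A \<and> (\<forall>c. \<forall>b\<in>B. c \<odot>\<^bsub>A\<^esub> b \<in> B)"

definition generated_alg :: "('f::field, 'm) module \<Rightarrow> 'm set \<Rightarrow> ('f, 'm) module" where
  "generated_alg A G = A\<lparr>carrier := \<Inter>{B. subalg B A \<and> G \<subseteq> B}\<rparr>"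

text \<open>
  Scalar multiplication of cosets follows the pattern of \<^const>\<open>rcoset_mult\<close>.
\<close>

definition quot_alg :: "('f::field, 'm) module \<Rightarrow> 'm set \<Rightarrow> ('f, 'm set) module" where
  "quot_alg A I =
    \<lparr>carrier = carrier (A Quot I), mult = mult (A Quot I), one = one (A Quot I),
     zero = zero (A Quot I), add = add (A Quot I),
     smult = (\<lambda>c K. \<Union>a\<in>K. I +>\<^bsub>A\<^esub> (c \<odot>\<^bsub>A\<^esub> a))\<rparr>"

definition direct_sum_alg :: "'i set \<Rightarrow> ('i \<Rightarrow> ('f::field, 'm) module) \<Rightarrow> ('f, 'i \<Rightarrow> 'm) module" where
  "direct_sum_alg I A =
    \<lparr>carrier = (\<Pi>\<^sub>E i\<in>I. carrier (A i)),
     mult = (\<lambda>x y. \<lambda>i\<in>I. x i \<otimes>\<^bsub>A i\<^esub> y i),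
     one = (\<lambda>i\<in>I. \<one>\<^bsub>A i\<^esub>),
     zero = (\<lambda>i\<in>I. \<zero>\<^bsub>A i\<^esub>),
     add = (\<lambda>x y. \<lambda>i\<in>I. x i \<oplus>\<^bsub>A i\<^esub> y i),
     smult = (\<lambda>c x. \<lambda>i\<in>I. c \<odot>\<^bsub>A i\<^esub> x i)\<rparr>"

definition alg_isomorphic :: "('f::field, 'm) module \<Rightarrow> ('f, 'k) module \<Rightarrow> bool" where
  "alg_isomorphic A B \<longleftrightarrow>
    (\<exists>\<phi>\<in>ring_iso A B. \<forall>c. \<forall>a\<in>carrier A. \<phi> (c \<odot>\<^bsub>A\<^esub> a) = c \<odot>\<^bsub>B\<^esub> \<phi> a)"

text \<open>
  The full matrix algebra with rows and columns indexed by a finite set \<open>I\<close>. A matrix is a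
  function of two indices that vanishes outside \<open>I \<times> I\<close>.
\<close>

definition matrix_alg :: "'i set \<Rightarrow> ('f::field, 'i \<Rightarrow> 'i \<Rightarrow> 'f) module" where
  "matrix_alg I =
    \<lparr>carrier = {M. \<forall>i j. (i, j) \<notin> I \<times> I \<longrightarrow> M i j = 0},
     mult = (\<lambda>M N i j. \<Sum>k\<in>I. M i k * N k j),
     one = (\<lambda>i j. if i = j \<and> i \<in> I then 1 else 0),
     zero = (\<lambda>i j. 0),
     add = (\<lambda>M N i j. M i j + N i j),
     smult = (\<lambda>c M i j. c * M i j)\<rparr>"

abbreviation square_matrix_alg :: "nat \<Rightarrow> ('f::field, nat \<Rightarrow> nat \<Rightarrow> 'f) module" where
  "square_matrix_alg k \<equiv> matrix_alg {1..k}"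


section \<open>The Jacobson radical\<close>

definition left_ideal :: "'a set \<Rightarrow> ('a, 'b) ring_scheme \<Rightarrow> bool" where
  "left_ideal L R \<longleftrightarrow>
    additive_subgroup L R \<and> (\<forall>r\<in>carrier R. \<forall>l\<in>L. r \<otimes>\<^bsub>R\<^esub> l \<in> L)"

definition maximal_left_ideal :: "'a set \<Rightarrow> ('a, 'b) ring_scheme \<Rightarrow> bool" where
  "maximal_left_ideal L R \<longleftrightarrow>
    left_ideal L R \<and> L \<noteq> carrier R \<and>
    (\<forall>K. left_ideal K R \<and> L \<subseteq> K \<longrightarrow> K = L \<or> K = carrier R)"

definition jacobson_radical :: "('a, 'b) ring_scheme \<Rightarrow> 'a set" where
  "jacobson_radical R = carrier R \<inter> \<Inter>{L. maximal_left_ideal L R}"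


section \<open>Factorial schemes and their Terwilliger algebras\<close>

definition points :: "nat \<Rightarrow> (nat \<Rightarrow> 'u set) \<Rightarrow> (nat \<Rightarrow> 'u) set" where
  "points n U = (\<Pi>\<^sub>E a\<in>{1..n}. U a)"

definition binary_tuples :: "nat \<Rightarrow> (nat \<Rightarrow> nat) set" where
  "binary_tuples n = (\<Pi>\<^sub>E a\<in>{1..n}. {0, 1})"

definition supp :: "nat \<Rightarrow> (nat \<Rightarrow> nat) \<Rightarrow> nat set" where
  "supp n g = {a \<in> {1..n}. g a = 1}"

definition big_part :: "(nat \<Rightarrow> 'u set) \<Rightarrow> nat set \<Rightarrow> nat set" where
  "big_part U V = {a \<in> V. card (U a) > 2}"

definition scheme_rel ::
  "nat \<Rightarrow> (nat \<Rightarrow> 'u set) \<Rightarrow> (nat \<Rightarrow> nat) \<Rightarrow> ((nat \<Rightarrow> 'u) \<times> (nat \<Rightarrow> 'u)) set" where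
  "scheme_rel n U g =
    {(y, z) \<in> points n U \<times> points n U. \<forall>a\<in>{1..n}. y a \<noteq> z a \<longleftrightarrow> g a = 1}"

definition valency :: "nat \<Rightarrow> (nat \<Rightarrow> 'u set) \<Rightarrow> (nat \<Rightarrow> nat) \<Rightarrow> nat" where
  "valency n U g = (\<Prod>a\<in>supp n g. card (U a) - 1)"

definition adjacency_mat ::
  "nat \<Rightarrow> (nat \<Rightarrow> 'u set) \<Rightarrow> (nat \<Rightarrow> nat) \<Rightarrow> (nat \<Rightarrow> 'u) \<Rightarrow> (nat \<Rightarrow> 'u) \<Rightarrow> 'f::field" where
  "adjacency_mat n U g = (\<lambda>y z. if (y, z) \<in> scheme_rel n U g then 1 else 0)"

definition dual_idempotent ::
  "nat \<Rightarrow> (nat \<Rightarrow> 'u set) \<Rightarrow> (nat \<Rightarrow> 'u) \<Rightarrow> (nat \<Rightarrow> nat) \<Rightarrow>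
    (nat \<Rightarrow> 'u) \<Rightarrow> (nat \<Rightarrow> 'u) \<Rightarrow> 'f::field" where
  "dual_idempotent n U x g = (\<lambda>y z. if y = z \<and> (x, y) \<in> scheme_rel n U g then 1 else 0)"

definition terwilliger_alg ::
  "nat \<Rightarrow> (nat \<Rightarrow> 'u set) \<Rightarrow> (nat \<Rightarrow> 'u) \<Rightarrow>
    ('f::field, (nat \<Rightarrow> 'u) \<Rightarrow> (nat \<Rightarrow> 'u) \<Rightarrow> 'f) module" where
  "terwilliger_alg n U x =
    generated_alg (matrix_alg (points n U))
      (adjacency_mat n U ` binary_tuples n \<union> dual_idempotent n U x ` binary_tuples n)"

type_synonym triple = "(nat \<Rightarrow> nat) \<times> (nat \<Rightarrow> nat) \<times> (nat \<Rightarrow> nat)"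

definition P_triples :: "nat \<Rightarrow> (nat \<Rightarrow> 'u set) \<Rightarrow> triple set" where
  "P_triples n U =
    {(a, b, c) \<in> binary_tuples n \<times> binary_tuples n \<times> binary_tuples n.
      sym_diff (supp n a) (supp n c) \<subseteq> supp n b \<and>
      supp n b \<subseteq> sym_diff (supp n a) (supp n c) \<union> big_part U (supp n a \<inter> supp n c)}"

text \<open>
  The field enters only through its characteristic, so it is passed as a type argument.
\<close>

definition D_triples :: "'f::field itself \<Rightarrow> nat \<Rightarrow> (nat \<Rightarrow> 'u set) \<Rightarrow> triple set" where
  "D_triples _ n U = {(a, b, c) \<in> P_triples n U. (of_nat (valency n U b) :: 'f) \<noteq> 0}"

definition D_rel :: "'f::field itself \<Rightarrow> nat \<Rightarrow> (nat \<Rightarrow> 'u set) \<Rightarrow> (triple \<times> triple) set" where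
  "D_rel F n U =
    {((g, h, i), (j, k, l)) \<in> D_triples F n U \<times> D_triples F n U.
      big_part U (supp n g \<inter> supp n i) - supp n h = big_part U (supp n j \<inter> supp n l) - supp n k}"

definition D_classes :: "'f::field itself \<Rightarrow> nat \<Rightarrow> (nat \<Rightarrow> 'u set) \<Rightarrow> triple set set" where
  "D_classes F n U = D_triples F n U // D_rel F n U"

definition diagonal_tuples :: "nat \<Rightarrow> triple set \<Rightarrow> (nat \<Rightarrow> nat) set" where
  "diagonal_tuples n C = {a \<in> binary_tuples n. \<exists>b\<in>binary_tuples n. (a, b, a) \<in> C}"

end

theory Submission
  imports Defs
begin

text \<open>
  The Terwilliger algebra is the tensor product, over the coordinates \<open>h\<close>, of the Terwilliger
  algebras of the complete graphs on \<open>U h\<close>. Let \<open>k\<close> be the image of \<open>|U h| - 1\<close> in the field. Such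
  a factor is spanned by the four (rescaled) all-ones blocks of the partition of \<open>U h\<close> into the
  base point and the rest, and by one further idempotent, which is zero if \<open>|U h| = 2\<close>. With the
  right scaling a product of two of these matrices is zero or again one of them. For \<open>k \<noteq> 0\<close> the
  blocks are the matrix units of a \<open>2 \<times> 2\<close> matrix algebra and the idempotent spans a second
  component. For \<open>k = 0\<close>, counting how many of the row and column indices of a block lie off the
  base point gives a grading in which everything of positive degree is nilpotent.

  Hence the tensors of positive degree span a nilpotent ideal. The tensors of degree zero are
  matrix units modulo this ideal: the set \<open>W\<close> of coordinates that carry the further idempotent
  selects the simple component, and the rows and columns of that component are indexed by
  \<open>D(W)\<close>. This set \<open>W\<close> is the invariant that defines the relation \<open>\<sim>\<close>.
\<close>

section \<open>The Jacobson radical and surjective homomorphisms\<close>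

text \<open>Closure under negation comes for free, because \<open>\<ominus> a\<close> is the product
  of \<open>\<ominus> \<one>\<close> and \<open>a\<close>.\<close>

lemma (in ring) left_idealI:
  assumes "L \<subseteq> carrier R" "\<zero> \<in> L"
    and add: "\<And>a b. a \<in> L \<Longrightarrow> b \<in> L \<Longrightarrow> a \<oplus> b \<in> L"
    and mult: "\<And>r a. r \<in> carrier R \<Longrightarrow> a \<in> L \<Longrightarrow> r \<otimes> a \<in> L"
  shows "left_ideal L R"
proof -
  have neg: "\<ominus> a \<in> L" if "a \<in> L" for a
  proof -
    have "a \<in> carrier R" using that assms(1) by auto
    then have "\<ominus> a = (\<ominus> \<one>) \<otimes> a" by (simp add: l_minus)
    then show ?thesis using mult[of "\<ominus> \<one>" a] that by simp
  qed
  have "subgroup L (add_monoid R)"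
    by (rule add.subgroupI) (use assms neg in \<open>auto simp: a_inv_def\<close>)
  then show ?thesis
    unfolding left_ideal_def using mult by (auto intro: additive_subgroup.intro)
qed

lemma left_idealD:
  assumes "left_ideal L R"
  shows "L \<subseteq> carrier R" "\<zero>\<^bsub>R\<^esub> \<in> L"
    "\<And>a b. a \<in> L \<Longrightarrow> b \<in> L \<Longrightarrow> a \<oplus>\<^bsub>R\<^esub> b \<in> L"
    "\<And>r a. r \<in> carrier R \<Longrightarrow> a \<in> L \<Longrightarrow> r \<otimes>\<^bsub>R\<^esub> a \<in> L"
  using assms unfolding left_ideal_def
  by (auto simp: additive_subgroup.zero_closed additive_subgroup.a_closed
      dest: additive_subgroup.a_subset)

text \<open>A left ideal \<open>K\<close> above the preimage of \<open>L\<close> contains the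
  kernel, because zero lies in \<open>L\<close>. So \<open>K\<close> is the full preimage of its own
  image, and maximality of \<open>L\<close> decides what that image can be.\<close>

lemma (in ring_hom_ring) maximal_left_ideal_vimage:
  assumes surj: "h ` carrier R = carrier S" and L: "maximal_left_ideal L S"
  shows "maximal_left_ideal {r \<in> carrier R. h r \<in> L} R"
proof -
  let ?V = "{r \<in> carrier R. h r \<in> L}"
  have LS: "left_ideal L S" "L \<noteq> carrier S"
    and max: "\<And>K. left_ideal K S \<Longrightarrow> L \<subseteq> K \<Longrightarrow> K = L \<or> K = carrier S"
    using L unfolding maximal_left_ideal_def by auto
  note Lp = left_idealD[OF LS(1)]
  have "left_ideal ?V R"
    by (rule R.left_idealI) (use Lp in auto)
  moreover have "?V \<noteq> carrier R"
  proof
    assume V: "?V = carrier R"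
    have "h ` carrier R \<subseteq> L"
    proof
      fix y assume "y \<in> h ` carrier R"
      then obtain r where "r \<in> ?V" "y = h r" using V by auto
      then show "y \<in> L" by simp
    qed
    then show False using surj LS(2) Lp(1) by auto
  qed
  moreover have "K = ?V \<or> K = carrier R" if K: "left_ideal K R" and VK: "?V \<subseteq> K" for K
  proof -
    note Kp = left_idealD[OF K]
    have "left_ideal (h ` K) S"
    proof (rule S.left_idealI)
      show "h ` K \<subseteq> carrier S" using Kp(1) by auto
      show "\<zero>\<^bsub>S\<^esub> \<in> h ` K" using Kp(2) by (metis hom_zero imageI)
      show "a \<oplus>\<^bsub>S\<^esub> b \<in> h ` K" if ab: "a \<in> h ` K" "b \<in> h ` K" for a b
      proof -
        obtain a' b' where 1: "a' \<in> K" "b' \<in> K" "a = h a'" "b = h b'" using ab by auto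
        then have "a \<oplus>\<^bsub>S\<^esub> b = h (a' \<oplus> b')" using Kp(1) by (simp add: subset_iff)
        then show ?thesis using Kp(3) 1 by auto
      qed
      show "r \<otimes>\<^bsub>S\<^esub> b \<in> h ` K" if rb: "r \<in> carrier S" "b \<in> h ` K" for r b
      proof -
        obtain r' b' where 1: "r' \<in> carrier R" "b' \<in> K" "r = h r'" "b = h b'" using rb surj by blast
        then have "r \<otimes>\<^bsub>S\<^esub> b = h (r' \<otimes> b')" using Kp(1) by (simp add: subset_iff)
        then show ?thesis using Kp(4) 1 by auto
      qed
    qed
    moreover have "L \<subseteq> h ` K"
    proof
      fix l assume l: "l \<in> L"
      then obtain r where "r \<in> carrier R" "l = h r" using Lp(1) surj by blast
      then show "l \<in> h ` K" using l VK by auto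
    qed
    ultimately have "h ` K = L \<or> h ` K = carrier S" by (rule max)
    then show ?thesis
    proof
      assume "h ` K = L"
      then show ?thesis using VK Kp(1) by auto
    next
      assume full: "h ` K = carrier S"
      have "r \<in> K" if r: "r \<in> carrier R" for r
      proof -
        obtain a where a: "a \<in> K" "h a = h r" using full r hom_closed by (metis imageE)
        have ac: "a \<in> carrier R" using a Kp(1) by auto
        have "h (r \<ominus> a) = \<zero>\<^bsub>S\<^esub>" using a ac r by (simp add: R.minus_eq S.r_neg)
        then have "r \<ominus> a \<in> K" using VK Lp(2) r ac by auto
        then have "(r \<ominus> a) \<oplus> a \<in> K" using a Kp(3) by auto
        then show ?thesis using r ac by (simp add: R.minus_eq R.a_assoc R.l_neg)
      qed
      then show ?thesis using Kp(1) by auto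
    qed
  qed
  ultimately show ?thesis unfolding maximal_left_ideal_def by blast
qed

text \<open>If a maximal left ideal \<open>L\<close> missed an element of \<open>K\<close>, then
  \<open>L\<close> and \<open>K\<close> together would span the ring and some \<open>b\<close> in
  \<open>K\<close> would be congruent to one modulo \<open>L\<close>. Nilpotency of \<open>b\<close>
  then forces one into \<open>L\<close>.\<close>

lemma (in ring) nil_ideal_subset_jacobson_radical:
  assumes K: "ideal K R" and nil: "\<And>a. a \<in> K \<Longrightarrow> \<exists>m::nat. a [^] m = \<zero>"
  shows "K \<subseteq> jacobson_radical R"
proof -
  interpret K: ideal K R by fact
  have "a \<in> L" if a: "a \<in> K" and L: "maximal_left_ideal L R" for a L
  proof (rule ccontr)
    assume "a \<notin> L"
    have L': "left_ideal L R" "L \<noteq> carrier R"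
      and max: "\<And>K. left_ideal K R \<Longrightarrow> L \<subseteq> K \<Longrightarrow> K = L \<or> K = carrier R"
      using L unfolding maximal_left_ideal_def by auto
    note Lp = left_idealD[OF L'(1)]
    have mem: "y \<in> L <+>\<^bsub>R\<^esub> K \<longleftrightarrow> (\<exists>l\<in>L. \<exists>b\<in>K. y = l \<oplus> b)" for y
      by (auto simp: set_add_def set_mult_def)
    have "left_ideal (L <+>\<^bsub>R\<^esub> K) R"
      unfolding left_ideal_def
    proof (intro conjI ballI)
      show "additive_subgroup (L <+>\<^bsub>R\<^esub> K) R"
        using L'(1) K.additive_subgroup_axioms
        by (auto simp: left_ideal_def intro: add_additive_subgroups)
      fix r y assume r: "r \<in> carrier R" and "y \<in> L <+>\<^bsub>R\<^esub> K"
      then obtain l b where lb: "l \<in> L" "b \<in> K" "y = l \<oplus> b" using mem by auto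
      then have "r \<otimes> y = r \<otimes> l \<oplus> r \<otimes> b" using r Lp(1) K.Icarr by (auto intro: r_distr)
      then show "r \<otimes> y \<in> L <+>\<^bsub>R\<^esub> K" using mem Lp(4) K.I_l_closed r lb by blast
    qed
    moreover have "L \<subseteq> L <+>\<^bsub>R\<^esub> K"
      using mem Lp(1) K.zero_closed by (metis r_zero subset_iff)
    moreover have "a \<in> L <+>\<^bsub>R\<^esub> K"
      using mem Lp(2) a K.Icarr by (metis l_zero)
    ultimately have "L <+>\<^bsub>R\<^esub> K = carrier R" using max \<open>a \<notin> L\<close> by blast
    then obtain l b where lb: "l \<in> L" "b \<in> K" "\<one> = l \<oplus> b" using mem by (metis one_closed)
    have car: "l \<in> carrier R" "b \<in> carrier R" using lb Lp(1) K.Icarr by auto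
    \<comment> \<open>Since \<open>b\<close> is \<open>1\<close> modulo \<open>L\<close>, so are all its powers; but some power vanishes.\<close>
    have pow: "\<exists>l'\<in>L. \<one> = l' \<oplus> b [^] m" for m :: nat
    proof (induction m)
      case 0
      show ?case using Lp(2) by (intro bexI[of _ \<zero>]) auto
    next
      case (Suc m)
      then obtain l' where l': "l' \<in> L" "\<one> = l' \<oplus> b [^] m" by auto
      have c': "l' \<in> carrier R" using l' Lp(1) by auto
      \<comment> \<open>The induction hypothesis is inserted to the right of \<open>b\<close>, so
        that the remainder \<open>b \<otimes> l'\<close> stays in the left ideal.\<close>
      have "\<one> = l \<oplus> b \<otimes> (l' \<oplus> b [^] m)" using l' lb(3) car by (metis r_one)
      also have "\<dots> = (l \<oplus> b \<otimes> l') \<oplus> b [^] Suc m"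
        using car c' unfolding nat_pow_Suc2[OF car(2)] by (simp add: r_distr a_assoc del: nat_pow_Suc)
      finally show ?case using Lp(3,4) l' lb car by blast
    qed
    obtain m :: nat where "b [^] m = \<zero>" using nil lb by auto
    with pow[of m] obtain l' where "l' \<in> L" "\<one> = l' \<oplus> \<zero>" by auto
    then have "\<one> \<in> L" using Lp(1) by (metis r_zero subsetD)
    then have "carrier R \<subseteq> L" using Lp(4) by (metis r_one subsetI)
    then show False using L'(2) Lp(1) by auto
  qed
  then show ?thesis unfolding jacobson_radical_def using K.Icarr by blast
qed

text \<open>The kernel is a nil ideal, hence inside the radical. Conversely, maximal left ideals of
  \<open>S\<close> pull back to maximal left ideals of \<open>R\<close>, so \<open>h\<close> maps
  the radical into the radical of \<open>S\<close>, which is zero.\<close>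

lemma (in ring_hom_ring) jacobson_radical_eq_kernel:
  assumes surj: "h ` carrier R = carrier S"
    and nil: "\<And>a. a \<in> carrier R \<Longrightarrow> h a = \<zero>\<^bsub>S\<^esub> \<Longrightarrow> \<exists>m::nat. a [^] m = \<zero>"
    and rad: "jacobson_radical S \<subseteq> {\<zero>\<^bsub>S\<^esub>}"
  shows "jacobson_radical R = a_kernel R S h"
proof
  have ker: "a \<in> a_kernel R S h \<longleftrightarrow> a \<in> carrier R \<and> h a = \<zero>\<^bsub>S\<^esub>" for a
    unfolding a_kernel_def' by blast
  show "a_kernel R S h \<subseteq> jacobson_radical R"
  proof (rule R.nil_ideal_subset_jacobson_radical[OF kernel_is_ideal])
    fix a assume "a \<in> a_kernel R S h"
    then show "\<exists>m::nat. a [^] m = \<zero>" using nil ker by blast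
  qed
  show "jacobson_radical R \<subseteq> a_kernel R S h"
  proof
    fix r assume r: "r \<in> jacobson_radical R"
    then have rc: "r \<in> carrier R" by (simp add: jacobson_radical_def)
    have max: "r \<in> V" if "maximal_left_ideal V R" for V
      using r that by (simp add: jacobson_radical_def)
    have "h r \<in> L" if "maximal_left_ideal L S" for L
      using max[OF maximal_left_ideal_vimage[OF surj that]] by simp
    then have "h r \<in> jacobson_radical S" using rc by (simp add: jacobson_radical_def)
    then show "r \<in> a_kernel R S h" using rad rc ker by blast
  qed
qed

text \<open>The first isomorphism theorem for rings supplies the map; only its compatibility with
  scalars remains. Scalar multiplication of a coset is a union over all representatives, and
  \<open>h\<close> takes a single value on that union.\<close>

lemma alg_isomorphic_quot_kernel:
  fixes A :: "('f::field, 'c) module" and B :: "('f, 'd) module"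
  assumes "ring_hom_ring A B h" and surj: "h ` carrier A = carrier B"
    and sm: "\<And>c a. a \<in> carrier A \<Longrightarrow> c \<odot>\<^bsub>A\<^esub> a \<in> carrier A"
    and hsm: "\<And>c a. a \<in> carrier A \<Longrightarrow> h (c \<odot>\<^bsub>A\<^esub> a) = c \<odot>\<^bsub>B\<^esub> h a"
  shows "alg_isomorphic (quot_alg A (a_kernel A B h)) B"
proof -
  interpret ring_hom_ring A B h by fact
  let ?K = "a_kernel A B h" and ?f = "\<lambda>X. the_elem (h ` X)"
  have ker: "a \<in> ?K \<longleftrightarrow> a \<in> carrier A \<and> h a = \<zero>\<^bsub>B\<^esub>" for a
    unfolding a_kernel_def' by blast
  have mem: "b \<in> ?K +>\<^bsub>A\<^esub> a \<longleftrightarrow> (\<exists>k\<in>?K. b = k \<oplus>\<^bsub>A\<^esub> a)" for a b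
    unfolding a_r_coset_def' by blast
  have coset: "h b = h a" "b \<in> carrier A" if a: "a \<in> carrier A" and b: "b \<in> ?K +>\<^bsub>A\<^esub> a" for a b
  proof -
    obtain k where k: "k \<in> carrier A" "h k = \<zero>\<^bsub>B\<^esub>" "b = k \<oplus>\<^bsub>A\<^esub> a" using b mem ker by blast
    then show "h b = h a" "b \<in> carrier A" using a by simp_all
  qed
  have self: "a \<in> ?K +>\<^bsub>A\<^esub> a" if "a \<in> carrier A" for a
  proof -
    have "\<zero>\<^bsub>A\<^esub> \<in> ?K" unfolding ker by simp
    moreover have "a = \<zero>\<^bsub>A\<^esub> \<oplus>\<^bsub>A\<^esub> a" using that by simp
    ultimately show ?thesis unfolding mem by blast
  qed
  have elem: "the_elem (h ` X) = y" if "X \<noteq> {}" "\<And>b. b \<in> X \<Longrightarrow> h b = y" for X y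
  proof -
    have "h ` X = {y}" using that by auto
    then show ?thesis by simp
  qed
  have "?f \<in> ring_iso (A Quot ?K) B" by (rule FactRing_iso_set[OF surj])
  then have "?f \<in> ring_iso (quot_alg A ?K) B"
    by (simp add: quot_alg_def ring_iso_def ring_hom_def)
  moreover have "?f (c \<odot>\<^bsub>quot_alg A ?K\<^esub> X) = c \<odot>\<^bsub>B\<^esub> ?f X"
    if "X \<in> carrier (quot_alg A ?K)" for c X
  proof -
    from that obtain a where a: "a \<in> carrier A" "X = ?K +>\<^bsub>A\<^esub> a"
      unfolding quot_alg_def FactRing_def A_RCOSETS_def' by auto
    have Xc: "b \<in> carrier A" if "b \<in> X" for b
      using that a coset(2) by simp
    have fX: "?f X = h a" by (rule elem) (use a self coset(1) in blast)+
    have "?f (\<Union>b\<in>X. ?K +>\<^bsub>A\<^esub> (c \<odot>\<^bsub>A\<^esub> b)) = c \<odot>\<^bsub>B\<^esub> h a"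
    proof (rule elem)
      show "(\<Union>b\<in>X. ?K +>\<^bsub>A\<^esub> (c \<odot>\<^bsub>A\<^esub> b)) \<noteq> {}" using a self[OF a(1)] self[OF sm] by blast
      fix y assume "y \<in> (\<Union>b\<in>X. ?K +>\<^bsub>A\<^esub> (c \<odot>\<^bsub>A\<^esub> b))"
      then obtain b where b: "b \<in> X" "y \<in> ?K +>\<^bsub>A\<^esub> (c \<odot>\<^bsub>A\<^esub> b)" by auto
      then have "h y = c \<odot>\<^bsub>B\<^esub> h b" using coset(1)[OF sm] hsm Xc by simp
      also have "h b = h a" using coset(1) a b by simp
      finally show "h y = c \<odot>\<^bsub>B\<^esub> h a" .
    qed
    then show ?thesis using fX by (simp add: quot_alg_def)
  qed
  ultimately show ?thesis unfolding alg_isomorphic_def by (intro bexI[of _ ?f] allI ballI) simp_all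
qed

section \<open>Direct sums of matrix algebras\<close>

lemma matrix_alg_simps:
  "M \<in> carrier (matrix_alg I) \<longleftrightarrow> (\<forall>i j. i \<notin> I \<or> j \<notin> I \<longrightarrow> M i j = 0)"
  "M \<otimes>\<^bsub>matrix_alg I\<^esub> N = (\<lambda>i j. \<Sum>k\<in>I. M i k * N k j)"
  "\<one>\<^bsub>matrix_alg I\<^esub> = (\<lambda>i j. if i = j \<and> i \<in> I then 1 else 0)"
  "\<zero>\<^bsub>matrix_alg I\<^esub> = (\<lambda>i j. 0)"
  "M \<oplus>\<^bsub>matrix_alg I\<^esub> N = (\<lambda>i j. M i j + N i j)"
  "c \<odot>\<^bsub>matrix_alg I\<^esub> M = (\<lambda>i j. c * M i j)"
  by (auto simp: matrix_alg_def)

lemma ring_matrix_alg: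
  assumes fin: "finite I"
  shows "ring (matrix_alg I :: ('f::field, _) module)"
proof (rule ringI)
  let ?R = "matrix_alg I :: ('f, _) module"
  show "abelian_group ?R"
  proof (rule abelian_groupI)
    fix M assume M: "M \<in> carrier ?R"
    show "\<exists>N\<in>carrier ?R. N \<oplus>\<^bsub>?R\<^esub> M = \<zero>\<^bsub>?R\<^esub>"
      by (rule bexI[of _ "\<lambda>i j. - M i j"]) (use M in \<open>auto simp: matrix_alg_simps\<close>)
  qed (auto simp: matrix_alg_simps algebra_simps)
  show "monoid ?R"
  proof (rule monoidI)
    fix M N P assume "M \<in> carrier ?R" "N \<in> carrier ?R" "P \<in> carrier ?R"
    show "M \<otimes>\<^bsub>?R\<^esub> N \<otimes>\<^bsub>?R\<^esub> P = M \<otimes>\<^bsub>?R\<^esub> (N \<otimes>\<^bsub>?R\<^esub> P)"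
      unfolding matrix_alg_simps sum_distrib_left sum_distrib_right mult.assoc
      by (intro ext) (rule sum.swap)
  next
    fix M assume M: "M \<in> carrier ?R"
    have "(\<Sum>k\<in>I. (if i = k \<and> i \<in> I then 1 else 0) * M k j) = M i j" for i j
    proof (cases "i \<in> I")
      case True
      then have "(\<Sum>k\<in>I. (if i = k \<and> i \<in> I then 1 else 0) * M k j) = (\<Sum>k\<in>I. if i = k then M k j else 0)"
        by (intro sum.cong) auto
      then show ?thesis using True fin by simp
    qed (use M in \<open>auto simp: matrix_alg_simps\<close>)
    then show "\<one>\<^bsub>?R\<^esub> \<otimes>\<^bsub>?R\<^esub> M = M" by (simp add: matrix_alg_simps)
    have "(\<Sum>k\<in>I. M i k * (if k = j \<and> k \<in> I then 1 else 0)) = M i j" for i j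
    proof (cases "j \<in> I")
      case True
      then have "(\<Sum>k\<in>I. M i k * (if k = j \<and> k \<in> I then 1 else 0)) = (\<Sum>k\<in>I. if k = j then M i k else 0)"
        by (intro sum.cong) auto
      then show ?thesis using True fin by simp
    next
      case False
      then have "M i j = 0" using M by (auto simp: matrix_alg_simps)
      moreover have "(\<Sum>k\<in>I. M i k * (if k = j \<and> k \<in> I then 1 else 0)) = 0"
        by (intro sum.neutral) (use False in auto)
      ultimately show ?thesis by simp
    qed
    then show "M \<otimes>\<^bsub>?R\<^esub> \<one>\<^bsub>?R\<^esub> = M" by (simp add: matrix_alg_simps)
  qed (auto simp: matrix_alg_simps)
qed (auto simp: matrix_alg_simps algebra_simps sum.distrib)

lemma direct_sum_alg_simps:
  "carrier (direct_sum_alg I A) = (\<Pi>\<^sub>E i\<in>I. carrier (A i))"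
  "X \<otimes>\<^bsub>direct_sum_alg I A\<^esub> Y = (\<lambda>i\<in>I. X i \<otimes>\<^bsub>A i\<^esub> Y i)"
  "\<one>\<^bsub>direct_sum_alg I A\<^esub> = (\<lambda>i\<in>I. \<one>\<^bsub>A i\<^esub>)"
  "\<zero>\<^bsub>direct_sum_alg I A\<^esub> = (\<lambda>i\<in>I. \<zero>\<^bsub>A i\<^esub>)"
  "X \<oplus>\<^bsub>direct_sum_alg I A\<^esub> Y = (\<lambda>i\<in>I. X i \<oplus>\<^bsub>A i\<^esub> Y i)"
  "c \<odot>\<^bsub>direct_sum_alg I A\<^esub> X = (\<lambda>i\<in>I. c \<odot>\<^bsub>A i\<^esub> X i)"
  by (auto simp: direct_sum_alg_def)

lemma ring_direct_sum_alg:
  fixes A :: "'i \<Rightarrow> ('f::field, 'm) module"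
  assumes A: "\<And>i. i \<in> I \<Longrightarrow> ring (A i)"
  shows "ring (direct_sum_alg I A)"
proof -
  let ?R = "direct_sum_alg I A"
  note ring_defs = direct_sum_alg_simps PiE_iff
  note laws = ring.ring_simprules(1-6,8,9)[OF A]
    monoid.l_one[OF ring.axioms(2)[OF A]] monoid.r_one[OF ring.axioms(2)[OF A]]
  have ext: "restrict X I = restrict Y I" if "\<And>i. i \<in> I \<Longrightarrow> X i = Y i"
    for X Y :: "'i \<Rightarrow> 'm" using that by (rule restrict_ext)
  have ext': "restrict X I = Y" if "\<And>i. i \<in> I \<Longrightarrow> X i = Y i" "Y \<in> extensional I"
    for X Y :: "'i \<Rightarrow> 'm" using that by (intro extensionalityI[of _ I]) auto
  show ?thesis
  proof (rule ringI)
    show "abelian_group ?R"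
    proof (rule abelian_groupI)
      fix X assume X: "X \<in> carrier ?R"
      show "\<exists>Y\<in>carrier ?R. Y \<oplus>\<^bsub>?R\<^esub> X = \<zero>\<^bsub>?R\<^esub>"
        by (rule bexI[of _ "\<lambda>i\<in>I. \<ominus>\<^bsub>A i\<^esub> X i"])
          (use X in \<open>simp_all add: ring_defs laws cong: restrict_cong\<close>)
    next
      fix X Y Z assume "X \<in> carrier ?R" "Y \<in> carrier ?R" "Z \<in> carrier ?R"
      then show "X \<oplus>\<^bsub>?R\<^esub> Y \<oplus>\<^bsub>?R\<^esub> Z = X \<oplus>\<^bsub>?R\<^esub> (Y \<oplus>\<^bsub>?R\<^esub> Z)"
        unfolding direct_sum_alg_simps
        by (intro ext) (simp add: PiE_iff ring.ring_simprules(7)[OF A])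
    next
      fix X Y assume "X \<in> carrier ?R" "Y \<in> carrier ?R"
      then show "X \<oplus>\<^bsub>?R\<^esub> Y = Y \<oplus>\<^bsub>?R\<^esub> X"
        unfolding direct_sum_alg_simps
        by (intro ext) (simp add: PiE_iff ring.ring_simprules(10)[OF A])
    next
      fix X assume "X \<in> carrier ?R"
      then show "\<zero>\<^bsub>?R\<^esub> \<oplus>\<^bsub>?R\<^esub> X = X"
        unfolding direct_sum_alg_simps by (intro ext') (simp_all add: PiE_iff laws)
    qed (simp_all add: ring_defs laws)
    show "monoid ?R"
    proof (rule monoidI)
      fix X Y Z assume "X \<in> carrier ?R" "Y \<in> carrier ?R" "Z \<in> carrier ?R"
      then show "X \<otimes>\<^bsub>?R\<^esub> Y \<otimes>\<^bsub>?R\<^esub> Z = X \<otimes>\<^bsub>?R\<^esub> (Y \<otimes>\<^bsub>?R\<^esub> Z)"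
        unfolding direct_sum_alg_simps
        by (intro ext) (simp add: PiE_iff ring.ring_simprules(11)[OF A])
    next
      fix X assume X: "X \<in> carrier ?R"
      show "\<one>\<^bsub>?R\<^esub> \<otimes>\<^bsub>?R\<^esub> X = X" "X \<otimes>\<^bsub>?R\<^esub> \<one>\<^bsub>?R\<^esub> = X"
        using X unfolding direct_sum_alg_simps by (intro ext'; simp add: PiE_iff laws)+
    qed (simp_all add: ring_defs laws)
  next
    fix X Y Z assume XYZ: "X \<in> carrier ?R" "Y \<in> carrier ?R" "Z \<in> carrier ?R"
    show "(X \<oplus>\<^bsub>?R\<^esub> Y) \<otimes>\<^bsub>?R\<^esub> Z = X \<otimes>\<^bsub>?R\<^esub> Z \<oplus>\<^bsub>?R\<^esub> Y \<otimes>\<^bsub>?R\<^esub> Z"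
      "Z \<otimes>\<^bsub>?R\<^esub> (X \<oplus>\<^bsub>?R\<^esub> Y) = Z \<otimes>\<^bsub>?R\<^esub> X \<oplus>\<^bsub>?R\<^esub> Z \<otimes>\<^bsub>?R\<^esub> Y"
      using XYZ unfolding direct_sum_alg_simps
      by (intro ext; simp add: PiE_iff ring.ring_simprules(13,23)[OF A])+
  qed
qed

text \<open>Fixing a component and a column, the elements for which this column vanishes form a
  maximal left ideal. Only zero has all its columns equal to zero.\<close>

lemma jacobson_radical_direct_sum_matrix_alg:
  fixes I :: "'g \<Rightarrow> 'i set"
  assumes fin: "\<And>g. g \<in> G \<Longrightarrow> finite (I g)"
  defines "S \<equiv> direct_sum_alg G (\<lambda>g. matrix_alg (I g) :: ('f::field, _) module)"
  shows "jacobson_radical S \<subseteq> {\<zero>\<^bsub>S\<^esub>}"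
proof
  interpret S: ring S unfolding S_def using fin by (intro ring_direct_sum_alg ring_matrix_alg)
  have car: "X \<in> carrier S \<longleftrightarrow>
      X \<in> extensional G \<and> (\<forall>g\<in>G. \<forall>i j. i \<notin> I g \<or> j \<notin> I g \<longrightarrow> X g i j = 0)" for X
    by (auto simp: S_def direct_sum_alg_simps matrix_alg_simps PiE_iff)
  have mult: "(X \<otimes>\<^bsub>S\<^esub> Y) g i j = (\<Sum>k\<in>I g. X g i k * Y g k j)" if "g \<in> G" for X Y g i j
    using that by (simp add: S_def direct_sum_alg_simps matrix_alg_simps)
  have add: "(X \<oplus>\<^bsub>S\<^esub> Y) g i j = X g i j + Y g i j" if "g \<in> G" for X Y g i j
    using that by (simp add: S_def direct_sum_alg_simps matrix_alg_simps)
  have zero: "\<zero>\<^bsub>S\<^esub> g i j = 0" if "g \<in> G" for g i j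
    using that by (simp add: S_def direct_sum_alg_simps matrix_alg_simps)
  have eqI: "X = Y" if "X \<in> carrier S" "Y \<in> carrier S" "\<And>g i j. g \<in> G \<Longrightarrow> X g i j = Y g i j" for X Y
    using that by (intro extensionalityI[of _ G] ext) (simp_all add: car)
  fix X assume X: "X \<in> jacobson_radical S"
  then have Xc: "X \<in> carrier S" by (simp add: jacobson_radical_def)
  have "X g i0 j = 0" if g: "g \<in> G" for g i0 j
  proof (cases "j \<in> I g")
    case j: True
    define L where "L = {Y \<in> carrier S. \<forall>i. Y g i j = 0}"
    have "maximal_left_ideal L S"
      unfolding maximal_left_ideal_def
    proof (intro conjI allI impI)
      show "left_ideal L S"
        by (rule S.left_idealI) (auto simp: L_def add[OF g] mult[OF g] zero[OF g])
      have "\<one>\<^bsub>S\<^esub> g j j = 1"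
        using g j by (simp add: S_def direct_sum_alg_simps matrix_alg_simps)
      then have "\<one>\<^bsub>S\<^esub> \<notin> L" by (auto simp: L_def intro: exI[of _ j])
      then show "L \<noteq> carrier S" using S.one_closed by metis
      fix K assume K: "left_ideal K S \<and> L \<subseteq> K"
      then have LK: "L \<subseteq> K" by simp
      note Kp = left_idealD[OF conjunct1[OF K]]
      show "K = L \<or> K = carrier S"
      proof (cases "K = L")
        case False
        then obtain Y i where Y: "Y \<in> K" "Y g i j \<noteq> 0" using LK Kp(1) by (auto simp: L_def)
        have Yc: "Y \<in> carrier S" using Y Kp(1) by auto
        have i: "i \<in> I g" using Y(2) Yc g by (auto simp: car)
        have "Z \<in> K" if Z: "Z \<in> carrier S" for Z
        proof -
          \<comment> \<open>\<open>M\<close> has one nonzero column, scaled so that \<open>M\<close>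
            times \<open>Y\<close> has the same column \<open>j\<close> in component
            \<open>g\<close> as \<open>Z\<close>. The difference \<open>D\<close> then lies in
            \<open>L\<close>, and \<open>Z\<close> is the sum of two elements of
            \<open>K\<close>.\<close>
          define M where "M = (\<lambda>g'\<in>G. \<lambda>a b. if g' = g \<and> b = i then Z g a j / Y g i j else 0)"
          have Mc: "M \<in> carrier S" using Z i g by (auto simp: car M_def)
          define D where "D = (\<lambda>g'\<in>G. \<lambda>a b. Z g' a b - (M \<otimes>\<^bsub>S\<^esub> Y) g' a b)"
          have MY: "M \<otimes>\<^bsub>S\<^esub> Y \<in> carrier S" using Mc Yc by simp
          then have Dc: "D \<in> carrier S" using Z by (auto simp: car D_def)
          have "(M \<otimes>\<^bsub>S\<^esub> Y) g a j = Z g a j" for a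
          proof -
            have "(M \<otimes>\<^bsub>S\<^esub> Y) g a j = (\<Sum>k\<in>I g. if k = i then Z g a j / Y g i j * Y g k j else 0)"
              unfolding mult[OF g] by (intro sum.cong) (auto simp: M_def g)
            then show ?thesis using i Y(2) fin[OF g] by simp
          qed
          then have "D \<in> L" using Dc g by (auto simp: L_def D_def)
          then have "(M \<otimes>\<^bsub>S\<^esub> Y) \<oplus>\<^bsub>S\<^esub> D \<in> K" using LK Kp(3,4) Mc Y by blast
          moreover have "(M \<otimes>\<^bsub>S\<^esub> Y) \<oplus>\<^bsub>S\<^esub> D = Z"
            by (rule eqI) (use MY Dc Z in \<open>auto simp: add D_def\<close>)
          ultimately show ?thesis by simp
        qed
        then show ?thesis using Kp(1) by auto
      qed simp
    qed
    then have "X \<in> L" using X by (auto simp: jacobson_radical_def)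
    then show ?thesis by (simp add: L_def)
  qed (use Xc g car in auto)
  then have "X = \<zero>\<^bsub>S\<^esub>" by (intro eqI) (auto simp: Xc zero)
  then show "X \<in> {\<zero>\<^bsub>S\<^esub>}" by simp
qed

lemma subalg_matrix_alg_lincomb:
  assumes B: "subalg B (matrix_alg X)" and "finite S" "\<And>s. s \<in> S \<Longrightarrow> M s \<in> B"
  shows "(\<lambda>y z. \<Sum>s\<in>S. c s * M s y z) \<in> B"
  using assms(2,3)
proof (induction S)
  case empty
  then show ?case
    using subringE(2)[of B "matrix_alg X"] B by (simp add: subalg_def matrix_alg_simps)
next
  case (insert s S)
  have "c s \<odot>\<^bsub>matrix_alg X\<^esub> M s \<in> B" using B insert.prems by (simp add: subalg_def)
  then have "(c s \<odot>\<^bsub>matrix_alg X\<^esub> M s) \<oplus>\<^bsub>matrix_alg X\<^esub> (\<lambda>y z. \<Sum>s\<in>S. c s * M s y z) \<in> B"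
    using subringE(7)[of B "matrix_alg X"] B insert by (simp add: subalg_def)
  then show ?case using insert.hyps by (simp add: matrix_alg_simps)
qed

section \<open>The factors of the tensor product\<close>

text \<open>
  \<open>Blk a c\<close> names the block of a coordinate matrix whose row (column) differs from the base point
  iff \<open>a\<close> (\<open>c\<close>); \<open>Std\<close> names the projection that is complementary to \<open>Blk True True\<close>.
\<close>

datatype idx = Blk bool bool | Std

lemma UNIV_idx: "UNIV = {Std, Blk False False, Blk False True, Blk True False, Blk True True}"
proof -
  have "i \<in> {Std, Blk False False, Blk False True, Blk True False, Blk True True}" for i
  proof (cases i)
    case (Blk a c)
    then show ?thesis by (cases a; cases c) auto
  qed simp
  then show ?thesis by blast
qed

instance idx :: finite
  by standard (simp add: UNIV_idx)

text \<open>Names the product of two coordinate matrices when it does not vanish for formal reasons;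
  that condition is kept apart in \<open>composable\<close>. \<open>Std\<close> acts as a unit here
  because it fixes every block that it does not annihilate.\<close>

fun idx_comp :: "idx \<Rightarrow> idx \<Rightarrow> idx" where
  "idx_comp (Blk a b) (Blk b' c) = Blk a c"
| "idx_comp Std j = j"
| "idx_comp i Std = i"

text \<open>\<open>k h\<close> is the valency of the complete graph on \<open>U h\<close>, read in
  the field. The points \<open>u h\<close> and, if there is room, \<open>v h\<close> off the base
  point are chosen as places at which coefficients can be read off.\<close>

locale terwilliger_coordinates =
  fixes n :: nat and U :: "nat \<Rightarrow> 'u set" and x u v :: "nat \<Rightarrow> 'u" and k :: "nat \<Rightarrow> 'f::field"
  assumes finite_U: "\<And>h. h \<in> {1..n} \<Longrightarrow> finite (U h)"
    and x_points: "x \<in> points n U"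
    and k_eq: "\<And>h. h \<in> {1..n} \<Longrightarrow> k h = of_nat (card (U h) - 1)"
    and u: "\<And>h. h \<in> {1..n} \<Longrightarrow> u h \<in> U h \<and> u h \<noteq> x h"
    and v: "\<And>h. h \<in> {1..n} \<Longrightarrow> card (U h) > 2 \<Longrightarrow> v h \<in> U h \<and> v h \<noteq> x h \<and> v h \<noteq> u h"
begin

text \<open>
  With \<open>inverse 0 = 0\<close>, the matrix for \<open>Std\<close> is idempotent whether or not \<open>k h\<close> vanishes. The
  scaling makes the basis multiplicative: a product of two basis matrices is zero or again a
  basis matrix.
\<close>

definition coord_mat :: "nat \<Rightarrow> idx \<Rightarrow> 'u \<Rightarrow> 'u \<Rightarrow> 'f" where
  "coord_mat h i y z = (case i of
     Blk a c \<Rightarrow> if (y \<noteq> x h) = a \<and> (z \<noteq> x h) = c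
                then (if c \<and> k h \<noteq> 0 then inverse (k h) else 1) else 0
   | Std \<Rightarrow> if y = x h \<or> z = x h then 0 else of_bool (y = z) - inverse (k h))"

text \<open>Two blocks that meet off the base point produce a factor \<open>k h\<close>, which the
  scaling absorbs unless it is zero. \<open>Std\<close> applied to the off-base side of a block
  gives the factor \<open>1 - k h * inverse (k h)\<close>, so it annihilates the block for nonzero
  \<open>k h\<close> and fixes it for \<open>k h = 0\<close>.\<close>

fun composable :: "nat \<Rightarrow> idx \<Rightarrow> idx \<Rightarrow> bool" where
  "composable h (Blk a b) (Blk b' c) \<longleftrightarrow> b = b' \<and> (b \<longrightarrow> k h \<noteq> 0)"
| "composable h Std Std \<longleftrightarrow> True"
| "composable h Std (Blk a c) \<longleftrightarrow> a \<and> k h = 0"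
| "composable h (Blk a c) Std \<longleftrightarrow> c \<and> k h = 0"

fun idx_deg :: "nat \<Rightarrow> idx \<Rightarrow> nat" where
  "idx_deg h (Blk a c) = (if k h = 0 then of_bool a + of_bool c else 0)"
| "idx_deg h Std = 0"

text \<open>If \<open>k h = 0\<close>, composable blocks meet at the base point, so the two middle
  indices that disappear have degree zero.\<close>

lemma idx_deg_comp: "composable h i j \<Longrightarrow> idx_deg h (idx_comp i j) = idx_deg h i + idx_deg h j"
  by (cases i; cases j) auto

section \<open>The multiplication table of the coordinate matrices\<close>

lemma x_in: "h \<in> {1..n} \<Longrightarrow> x h \<in> U h"
  using x_points by (auto simp: points_def)

lemma card_U_minus: "h \<in> {1..n} \<Longrightarrow> of_nat (card (U h - {x h})) = k h"
  by (simp add: k_eq x_in finite_U)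

lemma sum_U_split:
  "h \<in> {1..n} \<Longrightarrow> (\<Sum>w\<in>U h. g w) = g (x h) + (\<Sum>w\<in>U h - {x h}. g w)"
  by (simp add: sum.remove x_in finite_U)

text \<open>The action on a vector of the identity minus a multiple of the all-ones matrix, off the
  base point. With \<open>c = inverse (k h)\<close> this is the action of
  \<open>Std\<close>.\<close>

lemma sum_delta_minus:
  fixes g :: "'u \<Rightarrow> 'f"
  assumes "h \<in> {1..n}" "y \<in> U h" "y \<noteq> x h"
  shows "(\<Sum>w\<in>U h - {x h}. (of_bool (y = w) - c) * g w) = g y - c * (\<Sum>w\<in>U h - {x h}. g w)"
proof -
  have "(\<Sum>w\<in>U h - {x h}. (of_bool (y = w) - c) * g w)
      = (\<Sum>w\<in>U h - {x h}. if y = w then g w else 0) - (\<Sum>w\<in>U h - {x h}. c * g w)"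
    unfolding sum_subtractf[symmetric] by (intro sum.cong) (auto simp: algebra_simps)
  then show ?thesis using assms finite_U by (simp add: sum_distrib_left)
qed

text \<open>If the left factor is \<open>Std\<close>, its action is known from
  \<open>sum_delta_minus\<close>. If it is a block, each of its rows is constant on the part where
  it is supported, so the product is an entry of the block times a column sum of the right factor
  over that part.\<close>

lemma coord_mat_mult:
  assumes h: "h \<in> {1..n}" and yz: "y \<in> U h" "z \<in> U h"
  shows "(\<Sum>w\<in>U h. coord_mat h i y w * coord_mat h j w z)
    = (if composable h i j then coord_mat h (idx_comp i j) y z else 0)"
proof -
  let ?U = "U h - {x h}"
  \<comment> \<open>The column sum is one if \<open>k h = 0\<close>, by
    \<open>inverse 0 = 0\<close>, and zero otherwise.\<close>
  have Std_sum: "(\<Sum>w\<in>?U. coord_mat h Std w z) = (if z = x h then 0 else 1 - k h * inverse (k h))"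
  proof (cases "z = x h")
    case False
    have "(\<Sum>w\<in>?U. coord_mat h Std w z) = (\<Sum>w\<in>?U. (of_bool (z = w) - inverse (k h)) * 1)"
      using False by (intro sum.cong) (auto simp: coord_mat_def)
    then show ?thesis
      unfolding sum_delta_minus[OF h yz(2) False] using False card_U_minus[OF h] by simp
  qed (simp add: coord_mat_def)
  have Blk_sum: "(\<Sum>w\<in>?U. coord_mat h (Blk a b) w z) = k h * (if a then coord_mat h (Blk a b) (u h) z else 0)"
    for a b
  proof -
    have "(\<Sum>w\<in>?U. coord_mat h (Blk a b) w z) = (\<Sum>w\<in>?U. if a then coord_mat h (Blk a b) (u h) z else 0)"
      using u[OF h] by (intro sum.cong) (auto simp: coord_mat_def)
    then show ?thesis using card_U_minus[OF h] by simp
  qed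
  show ?thesis
  proof (cases i)
    case Std
    show ?thesis
    proof (cases "y = x h")
      case True
      then show ?thesis using Std by (cases j) (auto simp: coord_mat_def)
    next
      case False
      have "(\<Sum>w\<in>U h. coord_mat h i y w * coord_mat h j w z)
          = (\<Sum>w\<in>?U. (of_bool (y = w) - inverse (k h)) * coord_mat h j w z)"
        unfolding sum_U_split[OF h] using Std False
        by (auto simp: coord_mat_def intro!: sum.cong)
      also have "\<dots> = coord_mat h j y z - inverse (k h) * (\<Sum>w\<in>?U. coord_mat h j w z)"
        by (rule sum_delta_minus[OF h yz(1) False])
      also have "\<dots> = (if composable h i j then coord_mat h (idx_comp i j) y z else 0)"
      proof (cases j)
        case (Blk a c)
        then show ?thesis using Std False u[OF h] unfolding Blk Blk_sum
          by (auto simp: coord_mat_def)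
      next
        case j: Std
        then show ?thesis using Std unfolding j Std_sum
          by (cases "k h = 0") (auto simp: coord_mat_def)
      qed
      finally show ?thesis .
    qed
  next
    case (Blk a b)
    \<comment> \<open>The points \<open>u h\<close> and \<open>x h\<close> represent the off-base
      part and the base point.\<close>
    have row: "coord_mat h i y w = (if w \<noteq> x h \<longleftrightarrow> b then coord_mat h i y (if b then u h else x h) else 0)" for w
      using u[OF h] by (auto simp: coord_mat_def Blk)
    have "(\<Sum>w\<in>U h. coord_mat h i y w * coord_mat h j w z)
        = coord_mat h i y (if b then u h else x h) *
          (if b then (\<Sum>w\<in>?U. coord_mat h j w z) else coord_mat h j (x h) z)"
    proof (cases b)
      case True
      have "(\<Sum>w\<in>?U. coord_mat h i y w * coord_mat h j w z)
          = (\<Sum>w\<in>?U. coord_mat h i y (u h) * coord_mat h j w z)"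
        by (intro sum.cong refl) (use True in \<open>subst row, auto\<close>)
      then show ?thesis
        unfolding sum_U_split[OF h] using True by (subst row) (simp add: sum_distrib_left)
    next
      case False
      have "(\<Sum>w\<in>?U. coord_mat h i y w * coord_mat h j w z) = 0"
        by (intro sum.neutral ballI) (use False in \<open>subst row, auto\<close>)
      then show ?thesis unfolding sum_U_split[OF h] using False by simp
    qed
    also have "\<dots> = (if composable h i j then coord_mat h (idx_comp i j) y z else 0)"
    proof (cases j)
      case j: (Blk b' c)
      then show ?thesis using Blk u[OF h] unfolding j Blk_sum by (auto simp: coord_mat_def)
    next
      case j: Std
      then show ?thesis using Blk u[OF h] unfolding j Std_sum by (auto simp: coord_mat_def)
    qed
    finally show ?thesis .
  qed
qed

text \<open>For two points the matrix of \<open>Std\<close> is zero, so \<open>Std\<close> is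
  excluded as an index; this is what allows every coefficient of degree zero to be recovered from
  the matrix.\<close>

definition coord_idx :: "nat \<Rightarrow> idx set" where
  "coord_idx h = {i. i = Std \<longrightarrow> card (U h) > 2}"

lemma k_eq_1_if_small:
  assumes h: "h \<in> {1..n}" and small: "\<not> card (U h) > 2"
  shows "card (U h - {x h}) = 1" "k h = 1"
proof -
  have card: "card (U h - {x h}) = card (U h) - 1" using h x_in finite_U by simp
  have "u h \<in> U h - {x h}" using u h by auto
  then have "card (U h - {x h}) > 0" using finite_U h card_gt_0_iff by blast
  then show c1: "card (U h - {x h}) = 1" using small card by simp
  show "k h = 1" using c1 card_U_minus[OF h] by simp
qed

text \<open>There is a single point off the base point and \<open>k h = 1\<close>, so the only
  candidate entry is \<open>1 - 1\<close>.\<close>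

lemma coord_mat_Std_eq_0:
  assumes "h \<in> {1..n}" "Std \<notin> coord_idx h" "y \<in> U h" "z \<in> U h"
  shows "coord_mat h Std y z = 0"
proof -
  have small: "\<not> card (U h) > 2" using assms(2) by (simp add: coord_idx_def)
  obtain w where w: "U h - {x h} = {w}"
    using k_eq_1_if_small(1)[OF assms(1) small] by (rule card_1_singletonE)
  have "y = z" if "y \<noteq> x h" "z \<noteq> x h"
  proof -
    have "y \<in> U h - {x h}" "z \<in> U h - {x h}" using that assms(3,4) by simp_all
    then show ?thesis unfolding w by simp
  qed
  then show ?thesis using k_eq_1_if_small(2)[OF assms(1) small] by (auto simp: coord_mat_def)
qed

text \<open>An excluded \<open>Std\<close> contributes zero, so expansions can be checked over all
  five indices whatever the size of \<open>U h\<close>.\<close>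

lemma sum_coord_idx:
  assumes "h \<in> {1..n}" "y \<in> U h" "z \<in> U h"
  shows "(\<Sum>i\<in>coord_idx h. c i * coord_mat h i y z) =
    c Std * coord_mat h Std y z + c (Blk False False) * coord_mat h (Blk False False) y z
    + c (Blk False True) * coord_mat h (Blk False True) y z
    + c (Blk True False) * coord_mat h (Blk True False) y z
    + c (Blk True True) * coord_mat h (Blk True True) y z"
proof -
  have "(\<Sum>i\<in>coord_idx h. c i * coord_mat h i y z) = (\<Sum>i\<in>UNIV. c i * coord_mat h i y z)"
  proof (rule sum.mono_neutral_left)
    show "\<forall>i\<in>UNIV - coord_idx h. c i * coord_mat h i y z = 0"
    proof
      fix i assume "i \<in> UNIV - coord_idx h"
      then have "i = Std" "Std \<notin> coord_idx h" by (auto simp: coord_idx_def)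
      then show "c i * coord_mat h i y z = 0" using coord_mat_Std_eq_0 assms by simp
    qed
  qed auto
  then show ?thesis by (simp add: UNIV_idx algebra_simps)
qed

text \<open>
  For indices of degree \<open>0\<close>, the row \<open>dual_row\<close> and the column vector \<open>dual_vec\<close> pick out the
  coefficient of the basis matrix.
\<close>

definition dual_row :: "nat \<Rightarrow> idx \<Rightarrow> 'u" where
  "dual_row h i = (case i of Blk a c \<Rightarrow> if a then u h else x h | Std \<Rightarrow> u h)"

definition dual_vec :: "nat \<Rightarrow> idx \<Rightarrow> 'u \<Rightarrow> 'f" where
  "dual_vec h i z = (case i of Blk a c \<Rightarrow> of_bool ((z \<noteq> x h) = c)
                     | Std \<Rightarrow> of_bool (z = u h) - of_bool (z = v h))"

text \<open>Blocks are constant off the base point, so the difference of the values at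
  \<open>u h\<close> and \<open>v h\<close> detects only \<open>Std\<close>. For a block index whose
  columns lie off the base point, degree zero gives \<open>k h \<noteq> 0\<close>: the row sum of
  the block is then \<open>k h * inverse (k h) = 1\<close>, and that of \<open>Std\<close> is
  zero.\<close>

lemma coord_dual:
  assumes h: "h \<in> {1..n}" and i: "i \<in> coord_idx h" "idx_deg h i = 0"
  shows "(\<Sum>z\<in>U h. coord_mat h j (dual_row h i) z * dual_vec h i z) = of_bool (i = j)"
proof (cases i)
  case Std
  then have big: "card (U h) > 2" using i by (simp add: coord_idx_def)
  note uv = u[OF h] v[OF h big]
  have "(\<Sum>z\<in>U h. coord_mat h j (u h) z * dual_vec h i z)
      = (\<Sum>z\<in>U h. (if z = u h then coord_mat h j (u h) z else 0) - (if z = v h then coord_mat h j (u h) z else 0))"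
    using Std by (intro sum.cong) (auto simp: dual_vec_def)
  also have "\<dots> = coord_mat h j (u h) (u h) - coord_mat h j (u h) (v h)"
    unfolding sum_subtractf using uv finite_U[OF h] by simp
  also have "\<dots> = of_bool (i = j)"
    using uv Std by (cases j) (auto simp: coord_mat_def)
  finally show ?thesis using Std by (simp add: dual_row_def)
next
  case (Blk a c)
  define y where "y = (if a then u h else x h)"
  have y: "y \<in> U h" "(y \<noteq> x h) = a" using u[OF h] x_in[OF h] by (auto simp: y_def)
  have "(\<Sum>z\<in>U h. coord_mat h j (dual_row h i) z * dual_vec h i z)
      = (if c then (\<Sum>z\<in>U h - {x h}. coord_mat h j y z) else coord_mat h j y (x h))"
    unfolding sum_U_split[OF h] using Blk
    by (auto simp: dual_row_def dual_vec_def y_def intro!: sum.cong)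
  also have "\<dots> = of_bool (i = j)"
  proof (cases c)
    case False
    then show ?thesis using Blk y(2) by (cases j) (auto simp: coord_mat_def)
  next
    case True
    then have k0: "k h \<noteq> 0" using i Blk by (auto split: if_splits)
    show ?thesis
    proof (cases j)
      case j: (Blk a' c')
      have "(\<Sum>z\<in>U h - {x h}. coord_mat h j y z) = (\<Sum>z\<in>U h - {x h}. if a' = a \<and> c' then inverse (k h) else 0)"
        using y(2) k0 by (intro sum.cong) (auto simp: coord_mat_def j)
      then show ?thesis using True Blk j k0 card_U_minus[OF h] by auto
    next
      case Std
      have "(\<Sum>z\<in>U h - {x h}. coord_mat h j y z) = 0"
      proof (cases a)
        case True
        have "(\<Sum>z\<in>U h - {x h}. coord_mat h j y z)
          = (\<Sum>z\<in>U h - {x h}. (of_bool (y = z) - inverse (k h)) * 1)"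
          using y True by (intro sum.cong) (auto simp: coord_mat_def Std)
        then show ?thesis using sum_delta_minus[OF h y(1), of "inverse (k h)" "\<lambda>_. 1"] y(2) True k0 card_U_minus[OF h]
          by simp
      qed (use y(2) in \<open>simp add: coord_mat_def Std\<close>)
      then show ?thesis using True Blk Std by simp
    qed
  qed
  finally show ?thesis .
qed

subsection \<open>Tensor products of coordinate matrices\<close>

text \<open>The entries outside \<open>points n U\<close> are set to zero because the carrier of
  \<open>matrix_alg\<close> demands it.\<close>

definition tensor :: "(nat \<Rightarrow> 'u \<Rightarrow> 'u \<Rightarrow> 'f) \<Rightarrow> (nat \<Rightarrow> 'u) \<Rightarrow> (nat \<Rightarrow> 'u) \<Rightarrow> 'f" where
  "tensor N y z = (if y \<in> points n U \<and> z \<in> points n U then \<Prod>h\<in>{1..n}. N h (y h) (z h) else 0)"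

lemma finite_points: "finite (points n U)"
  unfolding points_def using finite_U by (intro finite_PiE) auto

lemma points_in: "y \<in> points n U \<Longrightarrow> h \<in> {1..n} \<Longrightarrow> y h \<in> U h"
  by (auto simp: points_def)

lemma tensor_cong:
  assumes "\<And>h y z. h \<in> {1..n} \<Longrightarrow> y \<in> U h \<Longrightarrow> z \<in> U h \<Longrightarrow> N h y z = N' h y z"
  shows "tensor N = tensor N'"
  by (intro ext) (auto simp: tensor_def intro!: prod.cong assms points_in)

text \<open>The mixed product rule for Kronecker products: a sum over points of products over
  coordinates is a product of coordinate sums.\<close>

lemma tensor_mult:
  "(\<Sum>w\<in>points n U. tensor N y w * tensor N' w z) = tensor (\<lambda>h y z. \<Sum>w\<in>U h. N h y w * N' h w z) y z"
proof (cases "y \<in> points n U \<and> z \<in> points n U")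
  case True
  have "(\<Sum>w\<in>points n U. tensor N y w * tensor N' w z)
      = (\<Sum>w\<in>points n U. \<Prod>h\<in>{1..n}. N h (y h) (w h) * N' h (w h) (z h))"
    using True by (intro sum.cong) (auto simp: tensor_def prod.distrib)
  also have "\<dots> = (\<Prod>h\<in>{1..n}. \<Sum>w\<in>U h. N h (y h) w * N' h w (z h))"
    unfolding points_def by (subst prod_sum_PiE) (auto intro: finite_U)
  finally show ?thesis using True by (simp add: tensor_def)
qed (auto simp: tensor_def)

text \<open>Multilinearity of the tensor product, by expanding the product of sums.\<close>

lemma tensor_sum:
  assumes "\<And>h. h \<in> {1..n} \<Longrightarrow> finite (J h)"
  shows "tensor (\<lambda>h y z. \<Sum>i\<in>J h. c h i * N h i y z) y z
    = (\<Sum>t\<in>Pi\<^sub>E {1..n} J. (\<Prod>h\<in>{1..n}. c h (t h)) * tensor (\<lambda>h. N h (t h)) y z)"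
proof (cases "y \<in> points n U \<and> z \<in> points n U")
  case True
  have "(\<Prod>h\<in>{1..n}. \<Sum>i\<in>J h. c h i * N h i (y h) (z h))
      = (\<Sum>t\<in>Pi\<^sub>E {1..n} J. \<Prod>h\<in>{1..n}. c h (t h) * N h (t h) (y h) (z h))"
    by (rule prod_sum_PiE) (use assms in auto)
  then show ?thesis using True by (simp add: tensor_def prod.distrib)
qed (auto simp: tensor_def)

definition indices :: "(nat \<Rightarrow> idx) set" where
  "indices = Pi\<^sub>E {1..n} coord_idx"

definition basis_mat :: "(nat \<Rightarrow> idx) \<Rightarrow> (nat \<Rightarrow> 'u) \<Rightarrow> (nat \<Rightarrow> 'u) \<Rightarrow> 'f" where
  "basis_mat t = tensor (\<lambda>h. coord_mat h (t h))"

definition composables :: "((nat \<Rightarrow> idx) \<times> (nat \<Rightarrow> idx)) set" where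
  "composables = {(t, s) \<in> indices \<times> indices. \<forall>h\<in>{1..n}. composable h (t h) (s h)}"

definition index_comp :: "(nat \<Rightarrow> idx) \<Rightarrow> (nat \<Rightarrow> idx) \<Rightarrow> nat \<Rightarrow> idx" where
  "index_comp t s = (\<lambda>h\<in>{1..n}. idx_comp (t h) (s h))"

lemma finite_indices: "finite indices"
  unfolding indices_def by (intro finite_PiE) auto

lemma finite_composables: "finite composables"
  by (rule finite_subset[of _ "indices \<times> indices"]) (auto simp: composables_def finite_indices)

lemma index_comp_in:
  assumes "t \<in> indices" "s \<in> indices"
  shows "index_comp t s \<in> indices"
proof -
  have "idx_comp i j \<in> coord_idx h" if "i \<in> coord_idx h" "j \<in> coord_idx h" for i j h
    using that by (cases i; cases j) (auto simp: coord_idx_def)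
  then show ?thesis using assms by (auto simp: index_comp_def indices_def PiE_iff)
qed

lemma basis_mat_mult:
  assumes "t \<in> indices" "s \<in> indices"
  shows "(\<Sum>w\<in>points n U. basis_mat t y w * basis_mat s w z)
    = (if (t, s) \<in> composables then basis_mat (index_comp t s) y z else 0)"
proof -
  have eq: "(\<Sum>w\<in>points n U. basis_mat t y w * basis_mat s w z)
    = tensor (\<lambda>h y z. if composable h (t h) (s h) then coord_mat h (idx_comp (t h) (s h)) y z else 0) y z"
    unfolding basis_mat_def tensor_mult
    by (intro tensor_cong[THEN fun_cong, THEN fun_cong] coord_mat_mult)
  show ?thesis
  proof (cases "(t, s) \<in> composables")
    case True
    then have "tensor (\<lambda>h y z. if composable h (t h) (s h) then coord_mat h (idx_comp (t h) (s h)) y z else 0)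
        = tensor (\<lambda>h. coord_mat h (index_comp t s h))"
      by (intro tensor_cong) (simp add: composables_def index_comp_def)
    then show ?thesis using True unfolding eq by (simp add: basis_mat_def)
  next
    case False
    then obtain h where h: "h \<in> {1..n}" "\<not> composable h (t h) (s h)"
      using assms by (auto simp: composables_def)
    have "(\<Prod>h\<in>{1..n}. if composable h (t h) (s h) then coord_mat h (idx_comp (t h) (s h)) (y h) (z h) else 0) = 0"
      by (rule prod_zero) (use h in auto)
    then show ?thesis using False unfolding eq tensor_def by simp
  qed
qed

section \<open>Linear combinations of basis matrices and their coefficient functions\<close>

definition lincomb :: "((nat \<Rightarrow> idx) \<Rightarrow> 'f) \<Rightarrow> (nat \<Rightarrow> 'u) \<Rightarrow> (nat \<Rightarrow> 'u) \<Rightarrow> 'f" where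
  "lincomb f y z = (\<Sum>t\<in>indices. f t * basis_mat t y z)"

text \<open>The product that the multiplication table of the basis matrices induces on coefficient
  functions.\<close>

definition convolution :: "((nat \<Rightarrow> idx) \<Rightarrow> 'f) \<Rightarrow> ((nat \<Rightarrow> idx) \<Rightarrow> 'f) \<Rightarrow> (nat \<Rightarrow> idx) \<Rightarrow> 'f" where
  "convolution f g r = (\<Sum>(t, s)\<in>{p \<in> composables. case_prod index_comp p = r}. f t * g s)"

lemma lincomb_mult:
  "(\<Sum>w\<in>points n U. lincomb f y w * lincomb g w z) = lincomb (convolution f g) y z"
proof -
  let ?c = "case_prod index_comp"
  have "(\<Sum>w\<in>points n U. lincomb f y w * lincomb g w z)
      = (\<Sum>w\<in>points n U. \<Sum>t\<in>indices. \<Sum>s\<in>indices. f t * g s * (basis_mat t y w * basis_mat s w z))"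
    unfolding lincomb_def sum_product by (intro sum.cong) (auto simp: algebra_simps)
  also have "\<dots> = (\<Sum>t\<in>indices. \<Sum>w\<in>points n U. \<Sum>s\<in>indices. f t * g s * (basis_mat t y w * basis_mat s w z))"
    by (rule sum.swap)
  also have "\<dots> = (\<Sum>t\<in>indices. \<Sum>s\<in>indices. \<Sum>w\<in>points n U. f t * g s * (basis_mat t y w * basis_mat s w z))"
    by (intro sum.cong refl sum.swap)
  also have "\<dots> = (\<Sum>t\<in>indices. \<Sum>s\<in>indices. if (t, s) \<in> composables then f t * g s * basis_mat (index_comp t s) y z else 0)"
    unfolding sum_distrib_left[symmetric] by (intro sum.cong) (auto simp: basis_mat_mult)
  also have "\<dots> = (\<Sum>(t, s)\<in>indices \<times> indices. if (t, s) \<in> composables then f t * g s * basis_mat (index_comp t s) y z else 0)"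
    by (rule sum.cartesian_product)
  also have "\<dots> = (\<Sum>(t, s)\<in>composables. f t * g s * basis_mat (index_comp t s) y z)"
    by (intro sum.mono_neutral_cong_right) (auto simp: composables_def finite_indices split: if_splits)
  also have "\<dots> = (\<Sum>r\<in>indices. \<Sum>(t, s)\<in>{p \<in> composables. ?c p = r}. f t * g s * basis_mat (index_comp t s) y z)"
  proof (rule sum.group[symmetric, OF finite_composables finite_indices])
    show "?c ` composables \<subseteq> indices" by (auto simp: composables_def intro: index_comp_in)
  qed
  also have "\<dots> = lincomb (convolution f g) y z"
    unfolding lincomb_def convolution_def sum_distrib_right
    by (intro sum.cong refl) auto
  finally show ?thesis .
qed

subsection \<open>The grading and the coefficients of degree zero\<close>

definition index_deg :: "(nat \<Rightarrow> idx) \<Rightarrow> nat" where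
  "index_deg t = (\<Sum>h\<in>{1..n}. idx_deg h (t h))"

text \<open>The filtration is imposed on coefficient functions and not on matrices, so that
  uniqueness of the expansion of a matrix does not enter.\<close>

definition min_deg :: "nat \<Rightarrow> ((nat \<Rightarrow> idx) \<Rightarrow> 'f) \<Rightarrow> bool" where
  "min_deg i f \<longleftrightarrow> (\<forall>t\<in>indices. f t \<noteq> 0 \<longrightarrow> i \<le> index_deg t)"

text \<open>Degrees add on composable pairs, and a nonzero coefficient of the convolution comes from
  at least one pair of nonzero coefficients.\<close>

lemma min_deg_convolution:
  assumes "min_deg i f" "min_deg j g"
  shows "min_deg (i + j) (convolution f g)"
  unfolding min_deg_def
proof (intro ballI impI)
  fix r assume "r \<in> indices" "convolution f g r \<noteq> 0"
  then obtain p where p: "p \<in> composables" "case_prod index_comp p = r" "(case p of (t, s) \<Rightarrow> f t * g s) \<noteq> 0"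
    unfolding convolution_def by (elim sum.not_neutral_contains_not_neutral) auto
  obtain t s where ts: "p = (t, s)" by (cases p)
  have "index_deg r = index_deg t + index_deg s"
    using p ts by (auto simp: index_deg_def composables_def index_comp_def idx_deg_comp
        simp flip: sum.distrib intro!: sum.cong)
  moreover have "t \<in> indices" "s \<in> indices" using p ts by (auto simp: composables_def)
  ultimately show "i + j \<le> index_deg r"
    using p(3) ts assms by (auto simp: min_deg_def intro!: add_mono)
qed

text \<open>A coordinate contributes at most two to the degree, one for the row and one for the
  column, so no index has degree above \<open>2 * n\<close>.\<close>

lemma lincomb_eq_0_if_min_deg:
  assumes "min_deg (Suc (2 * n)) f"
  shows "lincomb f y z = 0"
proof -
  have "index_deg t \<le> 2 * n" for t
  proof -
    have "idx_deg h i \<le> 2" for h i by (cases i) auto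
    then have "index_deg t \<le> (\<Sum>h\<in>{1..n}. 2)" unfolding index_deg_def by (intro sum_mono)
    then show ?thesis by simp
  qed
  then have "f t = 0" if "t \<in> indices" for t
    using assms that not_less_eq_eq unfolding min_deg_def by metis
  then show ?thesis by (simp add: lincomb_def)
qed

section \<open>Reading off the coefficients of degree zero\<close>

definition regular :: "(nat \<Rightarrow> idx) set" where
  "regular = {t \<in> indices. index_deg t = 0}"

text \<open>The tensor product of the coordinate functionals given by \<open>dual_row\<close> and
  \<open>dual_vec\<close>.\<close>

definition coeff :: "(nat \<Rightarrow> idx) \<Rightarrow> ((nat \<Rightarrow> 'u) \<Rightarrow> (nat \<Rightarrow> 'u) \<Rightarrow> 'f) \<Rightarrow> 'f" where
  "coeff t M = (\<Sum>z\<in>points n U. M (\<lambda>h\<in>{1..n}. dual_row h (t h)) z * (\<Prod>h\<in>{1..n}. dual_vec h (t h) (z h)))"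

lemma prod_of_bool: "finite S \<Longrightarrow> (\<Prod>h\<in>S. of_bool (P h)) = (of_bool (\<forall>h\<in>S. P h) :: 'f)"
  by (induction S rule: finite_induct) auto

lemma coeff_basis_mat:
  assumes t: "t \<in> regular" and s: "s \<in> indices"
  shows "coeff t (basis_mat s) = of_bool (t = s)"
proof -
  have row: "(\<lambda>h\<in>{1..n}. dual_row h (t h)) \<in> points n U"
    using u x_in by (auto simp: points_def dual_row_def split: idx.split)
  have "coeff t (basis_mat s) = (\<Sum>z\<in>points n U. \<Prod>h\<in>{1..n}. coord_mat h (s h) (dual_row h (t h)) (z h) * dual_vec h (t h) (z h))"
    unfolding coeff_def using row
    by (intro sum.cong) (simp_all add: basis_mat_def tensor_def prod.distrib)
  also have "\<dots> = (\<Prod>h\<in>{1..n}. \<Sum>z\<in>U h. coord_mat h (s h) (dual_row h (t h)) z * dual_vec h (t h) z)"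
    unfolding points_def by (rule prod_sum_PiE[symmetric]) (auto intro: finite_U)
  also have "\<dots> = (\<Prod>h\<in>{1..n}. of_bool (t h = s h))"
    by (intro prod.cong coord_dual) (use t in \<open>auto simp: regular_def indices_def index_deg_def\<close>)
  also have "\<dots> = of_bool (t = s)"
  proof -
    have "(\<forall>h\<in>{1..n}. t h = s h) \<longleftrightarrow> t = s"
      using t s by (auto simp: regular_def indices_def intro: PiE_ext)
    then show ?thesis by (simp only: prod_of_bool finite_atLeastAtMost)
  qed
  finally show ?thesis .
qed

text \<open>Consequently the coefficients of degree zero depend only on the matrix and not on the
  chosen expansion.\<close>

lemma coeff_lincomb:
  assumes "t \<in> regular"
  shows "coeff t (lincomb f) = f t"
proof -
  have "coeff t (lincomb f) = (\<Sum>s\<in>indices. f s * coeff t (basis_mat s))"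
    unfolding coeff_def lincomb_def sum_distrib_left sum_distrib_right mult.assoc by (rule sum.swap)
  also have "\<dots> = (\<Sum>s\<in>indices. if t = s then f s else 0)"
    by (intro sum.cong) (auto simp: coeff_basis_mat[OF assms])
  also have "\<dots> = f t" using assms by (simp add: finite_indices regular_def)
  finally show ?thesis .
qed

subsection \<open>The Terwilliger algebra is the span of the basis matrices\<close>

lemma tensor_in_lincomb:
  assumes "\<And>h y z. h \<in> {1..n} \<Longrightarrow> y \<in> U h \<Longrightarrow> z \<in> U h \<Longrightarrow>
    N h y z = (\<Sum>i\<in>coord_idx h. c h i * coord_mat h i y z)"
  shows "tensor N \<in> range lincomb"
proof -
  have "tensor N = tensor (\<lambda>h y z. \<Sum>i\<in>coord_idx h. c h i * coord_mat h i y z)"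
    by (rule tensor_cong) (rule assms)
  also have "\<dots> = lincomb (\<lambda>t. \<Prod>h\<in>{1..n}. c h (t h))"
    by (intro ext) (simp only: tensor_sum finite lincomb_def indices_def basis_mat_def)
  finally show ?thesis by simp
qed

section \<open>The generators as combinations of basis matrices\<close>

lemma adjacency_mat_tensor:
  "adjacency_mat n U g = tensor (\<lambda>h y z. of_bool ((y \<noteq> z) = (g h = 1)))"
  by (intro ext) (auto simp: adjacency_mat_def scheme_rel_def tensor_def prod_of_bool)

lemma dual_idempotent_tensor:
  "dual_idempotent n U x g = tensor (\<lambda>h y z. of_bool (y = z \<and> (y \<noteq> x h) = (g h = 1)))"
proof (intro ext)
  fix y z
  have eq: "y = z \<longleftrightarrow> (\<forall>h\<in>{1..n}. y h = z h)" if "y \<in> points n U" "z \<in> points n U"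
    using that by (auto simp: points_def intro: PiE_ext)
  have rel: "(x, y) \<in> scheme_rel n U g \<longleftrightarrow> y \<in> points n U \<and> (\<forall>h\<in>{1..n}. (y h \<noteq> x h) = (g h = 1))"
    using x_points unfolding scheme_rel_def by (simp add: eq_commute[of "x _"])
  have "tensor (\<lambda>h y z. of_bool (y = z \<and> (y \<noteq> x h) = (g h = 1))) y z
      = (of_bool (y \<in> points n U \<and> z \<in> points n U \<and>
          (\<forall>h\<in>{1..n}. y h = z h) \<and> (\<forall>h\<in>{1..n}. (y h \<noteq> x h) = (g h = 1))) :: 'f)"
  proof (cases "y \<in> points n U \<and> z \<in> points n U")
    case True
    then show ?thesis
      by (simp only: tensor_def prod_of_bool ball_conj_distrib finite_atLeastAtMost simp_thms if_True)
  qed (auto simp: tensor_def)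
  then show "dual_idempotent n U x g y z = tensor (\<lambda>h y z. of_bool (y = z \<and> (y \<noteq> x h) = (g h = 1))) y z"
    unfolding dual_idempotent_def rel using eq by (cases "y \<in> points n U \<and> z \<in> points n U") auto
qed

lemma adjacency_mat_in_lincomb: "adjacency_mat n U g \<in> range lincomb"
  unfolding adjacency_mat_tensor
proof (rule tensor_in_lincomb)
  fix h y z assume h: "h \<in> {1..n}" "y \<in> U h" "z \<in> U h"
  \<comment> \<open>Off the base point the identity is \<open>Std + Blk True True\<close> for
    nonzero \<open>k h\<close> and \<open>Std\<close> for \<open>k h = 0\<close>, while the all-ones
    block is \<open>k h\<close> times \<open>Blk True True\<close>, respectively
    \<open>Blk True True\<close> itself. The coefficients for \<open>g h = 1\<close> express
    all-ones minus identity, the others the identity.\<close>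
  show "of_bool ((y \<noteq> z) = (g h = 1)) = (\<Sum>i\<in>coord_idx h.
      (if g h = 1 then case i of Std \<Rightarrow> - 1
         | Blk a c \<Rightarrow> if a then (if c then (if k h = 0 then 1 else k h - 1) else 1)
                      else (if c then (if k h = 0 then 1 else k h) else 0)
       else case i of Std \<Rightarrow> 1 | Blk a c \<Rightarrow> of_bool (a = c \<and> (a \<longrightarrow> k h \<noteq> 0))) * coord_mat h i y z)"
    unfolding sum_coord_idx[OF h]
    by (cases "y = x h"; cases "z = x h"; cases "k h = 0"; cases "g h = 1") (simp_all add: coord_mat_def left_diff_distrib)
qed

lemma dual_idempotent_in_lincomb: "dual_idempotent n U x g \<in> range lincomb"
  unfolding dual_idempotent_tensor
proof (rule tensor_in_lincomb)
  fix h y z assume h: "h \<in> {1..n}" "y \<in> U h" "z \<in> U h"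
  show "of_bool (y = z \<and> (y \<noteq> x h) = (g h = 1)) = (\<Sum>i\<in>coord_idx h.
      (case i of Std \<Rightarrow> of_bool (g h = 1)
         | Blk a c \<Rightarrow> of_bool (a = c \<and> a = (g h = 1) \<and> (a \<longrightarrow> k h \<noteq> 0))) * coord_mat h i y z)"
    unfolding sum_coord_idx[OF h]
    by (cases "y = x h"; cases "z = x h"; cases "k h = 0"; cases "g h = 1") (simp_all add: coord_mat_def)
qed

text \<open>The identity is the adjacency matrix of the zero tuple. The constant zero function can
  stand for this tuple, since \<open>adjacency_mat\<close> only reads values on
  \<open>{1..n}\<close>.\<close>

lemma one_in_lincomb: "\<one>\<^bsub>matrix_alg (points n U)\<^esub> \<in> range lincomb"
proof -
  have "\<one>\<^bsub>matrix_alg (points n U)\<^esub> = (adjacency_mat n U (\<lambda>_. 0) :: _ \<Rightarrow> _ \<Rightarrow> 'f)"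
    by (intro ext) (auto simp: matrix_alg_simps adjacency_mat_def scheme_rel_def points_def
        intro: PiE_ext)
  then show ?thesis using adjacency_mat_in_lincomb by simp
qed

lemma lincomb_carrier: "lincomb f \<in> carrier (matrix_alg (points n U))"
  by (auto simp: matrix_alg_simps lincomb_def basis_mat_def tensor_def)

lemma lincomb_ops:
  "lincomb f \<otimes>\<^bsub>matrix_alg (points n U)\<^esub> lincomb g = lincomb (convolution f g)"
  "lincomb f \<oplus>\<^bsub>matrix_alg (points n U)\<^esub> lincomb g = lincomb (\<lambda>t. f t + g t)"
  "c \<odot>\<^bsub>matrix_alg (points n U)\<^esub> lincomb f = lincomb (\<lambda>t. c * f t)"
proof -
  show "lincomb f \<otimes>\<^bsub>matrix_alg (points n U)\<^esub> lincomb g = lincomb (convolution f g)"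
    by (intro ext) (simp only: matrix_alg_simps lincomb_mult)
qed (intro ext, simp add: matrix_alg_simps lincomb_def sum.distrib sum_distrib_left algebra_simps)+

lemma subalg_lincomb: "subalg (range lincomb) (matrix_alg (points n U))"
proof -
  interpret R: ring "matrix_alg (points n U) :: ('f, _) module"
    by (rule ring_matrix_alg[OF finite_points])
  have neg: "\<ominus>\<^bsub>matrix_alg (points n U)\<^esub> lincomb f = lincomb (\<lambda>t. - f t)" for f
  proof (rule R.minus_equality)
    show "lincomb (\<lambda>t. - f t) \<oplus>\<^bsub>matrix_alg (points n U)\<^esub> lincomb f = \<zero>\<^bsub>matrix_alg (points n U)\<^esub>"
      unfolding lincomb_ops by (intro ext) (simp add: lincomb_def matrix_alg_simps)
  qed (rule lincomb_carrier)+
  have "subring (range lincomb) (matrix_alg (points n U))"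
  proof (rule R.subringI)
    show "range lincomb \<subseteq> carrier (matrix_alg (points n U))" using lincomb_carrier by blast
    show "\<one>\<^bsub>matrix_alg (points n U)\<^esub> \<in> range lincomb" by (rule one_in_lincomb)
  next
    fix M assume "M \<in> range lincomb"
    then obtain f where "M = lincomb f" by blast
    then show "\<ominus>\<^bsub>matrix_alg (points n U)\<^esub> M \<in> range lincomb" by (simp add: neg)
  next
    fix M N assume "M \<in> range lincomb" "N \<in> range lincomb"
    then obtain f g where fg: "M = lincomb f" "N = lincomb g" by blast
    show "M \<otimes>\<^bsub>matrix_alg (points n U)\<^esub> N \<in> range lincomb"
      "M \<oplus>\<^bsub>matrix_alg (points n U)\<^esub> N \<in> range lincomb"
      unfolding fg lincomb_ops by simp_all
  qed
  moreover have "c \<odot>\<^bsub>matrix_alg (points n U)\<^esub> M \<in> range lincomb" if M: "M \<in> range lincomb" for c M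
  proof -
    obtain f where f: "M = lincomb f" using M by blast
    show ?thesis unfolding f lincomb_ops by simp
  qed
  ultimately show ?thesis unfolding subalg_def by simp
qed

section \<open>The basis matrices as elements of the generated algebra\<close>

lemma tensor_matrix_mult:
  "tensor N \<otimes>\<^bsub>matrix_alg (points n U)\<^esub> tensor N' = tensor (\<lambda>h y z. \<Sum>w\<in>U h. N h y w * N' h w z)"
  by (intro ext) (simp only: matrix_alg_simps tensor_mult)

text \<open>An adjacency matrix between two dual idempotents is cut down to one choice of row part,
  column part and relation. Every basis matrix is a combination of such pieces.\<close>

lemma basis_mat_in_subalg:
  assumes B: "subalg B (matrix_alg (points n U))"
    and A: "adjacency_mat n U ` binary_tuples n \<subseteq> B"
    and E: "dual_idempotent n U x ` binary_tuples n \<subseteq> B"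
  shows "basis_mat t \<in> B"
proof -
  define row where "row h = (case t h of Blk a c \<Rightarrow> a | Std \<Rightarrow> True)" for h
  define col where "col h = (case t h of Blk a c \<Rightarrow> c | Std \<Rightarrow> True)" for h
  \<comment> \<open>The values of the coordinate matrix on its block: \<open>b = 0\<close> on the
    diagonal, \<open>b = 1\<close> off the diagonal.\<close>
  define d :: "nat \<Rightarrow> nat \<Rightarrow> 'f" where "d h b = (case t h of
      Blk a c \<Rightarrow> (if c \<and> k h \<noteq> 0 then inverse (k h) else 1)
    | Std \<Rightarrow> (if b = 0 then 1 else 0) - inverse (k h))" for h b
  \<comment> \<open>The coordinate factor of the triple product of dual idempotent, adjacency matrix
    and dual idempotent.\<close>
  define C :: "nat \<Rightarrow> nat \<Rightarrow> 'u \<Rightarrow> 'u \<Rightarrow> 'f" where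
    "C h b y z = of_bool ((y \<noteq> x h) = row h \<and> (y \<noteq> z) = (b = 1) \<and> (z \<noteq> x h) = col h)" for h b y z
  let ?r = "\<lambda>h\<in>{1..n}. if row h then 1 else (0::nat)" and ?c = "\<lambda>h\<in>{1..n}. if col h then 1 else (0::nat)"
  have bin: "?r \<in> binary_tuples n" "?c \<in> binary_tuples n" by (auto simp: binary_tuples_def)
  have C: "tensor (\<lambda>h. C h (b h)) \<in> B" if b: "b \<in> binary_tuples n" for b
  proof -
    have mem: "dual_idempotent n U x ?r \<in> B" "adjacency_mat n U b \<in> B" "dual_idempotent n U x ?c \<in> B"
      using A E bin b by blast+
    have "dual_idempotent n U x ?r \<otimes>\<^bsub>matrix_alg (points n U)\<^esub> adjacency_mat n U b
        = tensor (\<lambda>h y z. of_bool ((y \<noteq> x h) = row h \<and> (y \<noteq> z) = (b h = 1)))"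
    proof -
      have "(\<Sum>w\<in>U h. of_bool (y = w \<and> (y \<noteq> x h) = (?r h = 1)) * of_bool ((w \<noteq> z) = (b h = 1)))
          = (of_bool ((y \<noteq> x h) = row h \<and> (y \<noteq> z) = (b h = 1)) :: 'f)"
        if h: "h \<in> {1..n}" "y \<in> U h" "z \<in> U h" for h y z
      proof -
        have "(\<Sum>w\<in>U h. of_bool (y = w \<and> (y \<noteq> x h) = (?r h = 1)) * of_bool ((w \<noteq> z) = (b h = 1)))
          = (\<Sum>w\<in>U h. if y = w then of_bool ((y \<noteq> x h) = row h \<and> (y \<noteq> z) = (b h = 1)) else (0::'f))"
          using h by (intro sum.cong) auto
        then show ?thesis using h finite_U by simp
      qed
      then show ?thesis
        unfolding dual_idempotent_tensor adjacency_mat_tensor tensor_matrix_mult by (rule tensor_cong)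
    qed
    moreover have "tensor (\<lambda>h y z. of_bool ((y \<noteq> x h) = row h \<and> (y \<noteq> z) = (b h = 1)))
          \<otimes>\<^bsub>matrix_alg (points n U)\<^esub> dual_idempotent n U x ?c = tensor (\<lambda>h. C h (b h))"
    proof -
      have "(\<Sum>w\<in>U h. of_bool ((y \<noteq> x h) = row h \<and> (y \<noteq> w) = (b h = 1)) * of_bool (w = z \<and> (w \<noteq> x h) = (?c h = 1)))
          = C h (b h) y z"
        if h: "h \<in> {1..n}" "y \<in> U h" "z \<in> U h" for h y z
      proof -
        have "(\<Sum>w\<in>U h. of_bool ((y \<noteq> x h) = row h \<and> (y \<noteq> w) = (b h = 1)) * of_bool (w = z \<and> (w \<noteq> x h) = (?c h = 1)))
          = (\<Sum>w\<in>U h. if w = z then C h (b h) y z else 0)"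
          using h by (intro sum.cong) (auto simp: C_def)
        then show ?thesis using h finite_U by simp
      qed
      then show ?thesis
        unfolding dual_idempotent_tensor tensor_matrix_mult by (rule tensor_cong)
    qed
    moreover have sub: "subring B (matrix_alg (points n U))" using B by (simp add: subalg_def)
    ultimately show ?thesis using subringE(6)[OF sub subringE(6)[OF sub mem(1,2)] mem(3)] by simp
  qed
  have "basis_mat t = tensor (\<lambda>h y z. \<Sum>b\<in>{0, 1}. d h b * C h b y z)"
    unfolding basis_mat_def
    by (rule tensor_cong) (auto simp: coord_mat_def d_def C_def row_def col_def split: idx.split)
  also have "\<dots> = (\<lambda>y z. \<Sum>b\<in>binary_tuples n. (\<Prod>h\<in>{1..n}. d h (b h)) * tensor (\<lambda>h. C h (b h)) y z)"
    unfolding binary_tuples_def by (intro ext tensor_sum) simp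
  also have "\<dots> \<in> B"
    by (rule subalg_matrix_alg_lincomb[OF B])
      (use C in \<open>auto simp: binary_tuples_def intro!: finite_PiE\<close>)
  finally show ?thesis .
qed

lemma terwilliger_alg_eq:
  "terwilliger_alg n U x = (matrix_alg (points n U))\<lparr>carrier := range lincomb\<rparr>"
proof -
  let ?G = "adjacency_mat n U ` binary_tuples n \<union> dual_idempotent n U x ` binary_tuples n ::
    ((nat \<Rightarrow> 'u) \<Rightarrow> (nat \<Rightarrow> 'u) \<Rightarrow> 'f) set"
  have G: "?G \<subseteq> range lincomb"
    using adjacency_mat_in_lincomb dual_idempotent_in_lincomb by blast
  have least: "range lincomb \<subseteq> B" if B: "subalg B (matrix_alg (points n U))" "?G \<subseteq> B" for B
  proof
    fix M assume "M \<in> range lincomb"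
    then obtain f where M: "M = lincomb f" by blast
    have "lincomb f = (\<lambda>y z. \<Sum>t\<in>indices. f t * basis_mat t y z)" by (intro ext) (rule lincomb_def)
    also have "\<dots> \<in> B"
      by (rule subalg_matrix_alg_lincomb[OF B(1) finite_indices])
        (use B in \<open>auto intro!: basis_mat_in_subalg\<close>)
    finally show "M \<in> B" unfolding M .
  qed
  have "\<Inter>{B. subalg B (matrix_alg (points n U)) \<and> ?G \<subseteq> B} = range lincomb"
  proof (intro equalityI Inter_greatest Inter_lower)
    show "range lincomb \<in> {B. subalg B (matrix_alg (points n U)) \<and> ?G \<subseteq> B}"
      using subalg_lincomb G by simp
  next
    fix B assume "B \<in> {B. subalg B (matrix_alg (points n U)) \<and> ?G \<subseteq> B}"
    then show "range lincomb \<subseteq> B" using least by simp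
  qed
  then show ?thesis unfolding terwilliger_alg_def generated_alg_def by simp
qed

subsection \<open>The simple components\<close>

text \<open>The rows and columns of the simple component selected by \<open>W\<close>. A coordinate
  in \<open>W\<close> lies off the base point, where \<open>Std\<close> lives. Outside
  \<open>W\<close>, if \<open>k h = 0\<close>, the only block of degree zero sits at the base
  point.\<close>

definition component :: "nat set \<Rightarrow> (nat \<Rightarrow> nat) set" where
  "component W = (\<Pi>\<^sub>E h\<in>{1..n}. if h \<in> W then {1} else if k h = 0 then {0} else {0, 1})"

text \<open>The matrix unit of the component \<open>W\<close> in row \<open>a\<close> and column
  \<open>c\<close>, modulo positive degree.\<close>

definition component_idx :: "nat set \<Rightarrow> (nat \<Rightarrow> nat) \<Rightarrow> (nat \<Rightarrow> nat) \<Rightarrow> nat \<Rightarrow> idx" where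
  "component_idx W a c = (\<lambda>h\<in>{1..n}. if h \<in> W then Std else Blk (a h = 1) (c h = 1))"

lemma finite_component: "finite (component W)"
  unfolding component_def by (intro finite_PiE) auto

lemma componentD:
  assumes "a \<in> component W" "h \<in> {1..n}"
  shows "h \<in> W \<Longrightarrow> a h = 1" "h \<notin> W \<Longrightarrow> k h = 0 \<Longrightarrow> a h = 0" "a h = 0 \<or> a h = 1"
  using assms unfolding component_def by (fastforce dest: PiE_mem split: if_splits)+

lemma component_idx_regular:
  assumes W: "W \<subseteq> big_part U {1..n}" and ac: "a \<in> component W" "c \<in> component W"
  shows "component_idx W a c \<in> regular"
proof -
  have "component_idx W a c \<in> indices"
    using W by (auto simp: component_idx_def indices_def coord_idx_def big_part_def)
  moreover have "idx_deg h (component_idx W a c h) = 0" if h: "h \<in> {1..n}" for h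
    using componentD[OF ac(1) h] componentD[OF ac(2) h] h by (auto simp: component_idx_def)
  ultimately show ?thesis by (simp add: regular_def index_deg_def)
qed

text \<open>\<open>W\<close> collects the coordinates carrying \<open>Std\<close>; the tuples record
  the row and column parts of the blocks, and degree zero puts them into
  \<open>component W\<close>.\<close>

lemma regular_component_idx:
  assumes t: "t \<in> regular"
  obtains W a c where "W \<subseteq> big_part U {1..n}" "a \<in> component W" "c \<in> component W" "t = component_idx W a c"
proof -
  define W where "W = {h \<in> {1..n}. t h = Std}"
  define a :: "nat \<Rightarrow> nat" where "a = (\<lambda>h\<in>{1..n}. case t h of Std \<Rightarrow> 1 | Blk i j \<Rightarrow> of_bool i)"
  define c :: "nat \<Rightarrow> nat" where "c = (\<lambda>h\<in>{1..n}. case t h of Std \<Rightarrow> 1 | Blk i j \<Rightarrow> of_bool j)"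
  have ti: "t \<in> Pi\<^sub>E {1..n} coord_idx" and deg: "\<And>h. h \<in> {1..n} \<Longrightarrow> idx_deg h (t h) = 0"
    using t by (auto simp: regular_def indices_def index_deg_def)
  have 1: "W \<subseteq> big_part U {1..n}"
  proof
    fix h assume "h \<in> W"
    then have "h \<in> {1..n}" "t h = Std" by (simp_all add: W_def)
    moreover from this have "t h \<in> coord_idx h" using ti by (metis PiE_mem)
    ultimately show "h \<in> big_part U {1..n}" by (simp add: big_part_def coord_idx_def)
  qed
  have 2: "a \<in> component W" "c \<in> component W"
  proof -
    have "a h \<in> (if h \<in> W then {1} else if k h = 0 then {0} else {0, 1}) \<and>
          c h \<in> (if h \<in> W then {1} else if k h = 0 then {0} else {0, 1})" if h: "h \<in> {1..n}" for h
      using deg[OF h] h by (cases "t h") (auto simp: a_def c_def W_def split: if_splits)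
    moreover have "a \<in> extensional {1..n}" "c \<in> extensional {1..n}" by (simp_all add: a_def c_def)
    ultimately show "a \<in> component W" "c \<in> component W"
      unfolding component_def PiE_iff by simp_all
  qed
  have 3: "t = component_idx W a c"
  proof (rule PiE_ext[OF ti])
    show "component_idx W a c \<in> Pi\<^sub>E {1..n} coord_idx"
      using component_idx_regular[OF 1 2] by (simp add: regular_def indices_def)
    fix h assume h: "h \<in> {1..n}"
    then show "t h = component_idx W a c h"
      by (cases "t h") (auto simp: component_idx_def W_def a_def c_def)
  qed
  show ?thesis by (rule that[OF 1 2 3])
qed

text \<open>The places of \<open>Std\<close> determine \<open>W\<close>. The blocks determine the
  tuples outside \<open>W\<close>, and inside \<open>W\<close> the tuples are constantly
  one.\<close>

lemma component_idx_inj: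
  assumes eq: "component_idx W a c = component_idx W' a' c'"
    and W: "W \<subseteq> {1..n}" "W' \<subseteq> {1..n}"
    and ac: "a \<in> component W" "c \<in> component W" "a' \<in> component W'" "c' \<in> component W'"
  shows "W = W' \<and> a = a' \<and> c = c'"
proof -
  have h_eq: "(if h \<in> W then Std else Blk (a h = 1) (c h = 1)) = (if h \<in> W' then Std else Blk (a' h = 1) (c' h = 1))"
    if "h \<in> {1..n}" for h
    using fun_cong[OF eq, of h] that by (simp add: component_idx_def)
  have "h \<in> W \<longleftrightarrow> h \<in> W'" if "h \<in> {1..n}" for h
    using h_eq[OF that] by (auto split: if_splits)
  then have WW: "W = W'" using W by blast
  have vals: "a h = a' h \<and> c h = c' h" if h: "h \<in> {1..n}" for h
    using h_eq[OF h] componentD(1,3)[OF ac(1) h] componentD(1,3)[OF ac(2) h]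
      componentD(1,3)[OF ac(3) h] componentD(1,3)[OF ac(4) h] WW
    by (auto split: if_splits)
  have "a = a'" using ac(1,3) vals unfolding component_def WW by (intro PiE_ext[of a _ _ a']) auto
  moreover have "c = c'" using ac(2,4) vals unfolding component_def WW by (intro PiE_ext[of c _ _ c']) auto
  ultimately show ?thesis using WW by simp
qed

text \<open>This is matrix multiplication: the pairs of indices composing to the unit
  \<open>(a, c)\<close> correspond to the middle tuples \<open>b\<close>.\<close>

lemma convolution_component:
  assumes W: "W \<subseteq> big_part U {1..n}" and ac: "a \<in> component W" "c \<in> component W"
  shows "convolution f g (component_idx W a c)
    = (\<Sum>b\<in>component W. f (component_idx W a b) * g (component_idx W b c))"
proof -
  let ?F = "\<lambda>b. (component_idx W a b, component_idx W b c)"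
  let ?S = "{p \<in> composables. case_prod index_comp p = component_idx W a c}"
  have Wn: "W \<subseteq> {1..n}" using W by (auto simp: big_part_def)
  have reg: "component_idx W a b \<in> indices" if "a \<in> component W" "b \<in> component W" for a b
    using component_idx_regular[OF W that] by (simp add: regular_def)
  have "bij_betw ?F (component W) ?S"
    unfolding bij_betw_def
  proof (intro conjI inj_onI equalityI subsetI)
    fix b b' assume "b \<in> component W" "b' \<in> component W" "?F b = ?F b'"
    then show "b = b'" using component_idx_inj[of W a b W a b'] Wn ac by simp
  next
    fix p assume "p \<in> ?F ` component W"
    then obtain b where b: "b \<in> component W" "p = ?F b" by auto
    have "composable h (component_idx W a b h) (component_idx W b c h)" if h: "h \<in> {1..n}" for h
      using componentD(2)[OF b(1) h] h by (auto simp: component_idx_def)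
    moreover have "index_comp (component_idx W a b) (component_idx W b c) = component_idx W a c"
      unfolding index_comp_def component_idx_def by (rule restrict_ext) simp
    ultimately show "p \<in> ?S" using b ac reg by (simp add: composables_def)
  next
    fix p assume p: "p \<in> ?S"
    obtain t s where ts: "p = (t, s)" by (cases p)
    have tsi: "t \<in> indices" "s \<in> indices"
      and comp: "\<And>h. h \<in> {1..n} \<Longrightarrow> composable h (t h) (s h)"
      and ieq: "index_comp t s = component_idx W a c"
      using p ts by (simp_all add: composables_def)
    define b :: "nat \<Rightarrow> nat" where
      "b = (\<lambda>h\<in>{1..n}. case t h of Std \<Rightarrow> 1 | Blk i j \<Rightarrow> of_bool j)"
    \<comment> \<open>A product of \<open>Std\<close> with a block occurs only for
      \<open>k h = 0\<close> and yields a block touching the off-base part. Degree zero rules this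
      out, so both factors are \<open>Std\<close> on \<open>W\<close> and blocks elsewhere.\<close>
    have pt: "t h = component_idx W a b h \<and> s h = component_idx W b c h
        \<and> b h \<in> (if h \<in> W then {1} else if k h = 0 then {0} else {0, 1})" if h: "h \<in> {1..n}" for h
    proof -
      have "idx_comp (t h) (s h) = (if h \<in> W then Std else Blk (a h = 1) (c h = 1))"
        using fun_cong[OF ieq, of h] h by (simp add: index_comp_def component_idx_def)
      then show ?thesis
        using comp[OF h] h componentD[OF ac(1) h] componentD[OF ac(2) h]
        by (cases "t h"; cases "s h") (auto simp: component_idx_def b_def split: if_splits)
    qed
    have "b \<in> component W"
      unfolding component_def
    proof (rule PiE_I)
      show "b h = undefined" if "h \<notin> {1..n}" for h using that by (auto simp: b_def)
    qed (use pt in blast)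
    moreover have "t = component_idx W a b"
      using tsi(1) reg[OF ac(1) calculation] pt unfolding indices_def by (intro PiE_ext[of t]) auto
    moreover have "s = component_idx W b c"
      using tsi(2) reg[OF calculation(1) ac(2)] pt unfolding indices_def by (intro PiE_ext[of s]) auto
    ultimately show "p \<in> ?F ` component W" using ts by simp
  qed
  then have "(\<Sum>b\<in>component W. (\<lambda>(t, s). f t * g s) (?F b)) = (\<Sum>(t, s)\<in>?S. f t * g s)"
    by (rule sum.reindex_bij_betw)
  then show ?thesis by (simp add: convolution_def)
qed

text \<open>The map \<open>\<phi>\<close> arranges the coefficients of degree zero into matrices. It
  is a surjective homomorphism onto a ring with zero radical, and its kernel is nil because it
  consists of combinations in positive degree; so the kernel is the radical.\<close>

theorem quotient_isomorphic:
  fixes W :: "nat \<Rightarrow> nat set" and \<beta> :: "nat \<Rightarrow> nat \<Rightarrow> nat \<Rightarrow> nat" and d :: "nat \<Rightarrow> nat"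
  assumes W: "bij_betw W {1..N} (Pow (big_part U {1..n}))"
    and \<beta>: "\<And>g. g \<in> {1..N} \<Longrightarrow> bij_betw (\<beta> g) {1..d g} (component (W g))"
  defines "T \<equiv> (terwilliger_alg n U x :: ('f, _) module)"
  shows "alg_isomorphic (quot_alg T (jacobson_radical T))
    (direct_sum_alg {1..N} (\<lambda>g. square_matrix_alg (d g)))"
proof -
  let ?M = "matrix_alg (points n U) :: ('f, _) module"
  let ?S = "direct_sum_alg {1..N} (\<lambda>g. square_matrix_alg (d g)) :: ('f, _) module"
  define \<sigma> where "\<sigma> g i j = component_idx (W g) (\<beta> g i) (\<beta> g j)" for g i j
  define \<phi> where "\<phi> M = (\<lambda>g\<in>{1..N}. \<lambda>i j. if i \<in> {1..d g} \<and> j \<in> {1..d g} then coeff (\<sigma> g i j) M else 0)" for M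
  have T: "T = ?M\<lparr>carrier := range lincomb\<rparr>" unfolding T_def by (rule terwilliger_alg_eq)
  have T_ops: "M \<otimes>\<^bsub>T\<^esub> M' = M \<otimes>\<^bsub>?M\<^esub> M'" "M \<oplus>\<^bsub>T\<^esub> M' = M \<oplus>\<^bsub>?M\<^esub> M'" "\<one>\<^bsub>T\<^esub> = \<one>\<^bsub>?M\<^esub>"
    "c \<odot>\<^bsub>T\<^esub> M = c \<odot>\<^bsub>?M\<^esub> M" "carrier T = range lincomb" "\<zero>\<^bsub>T\<^esub> = (\<lambda>y z. 0)" for M M' c
    by (simp_all add: T matrix_alg_simps(4))
  have ringT: "ring T"
    unfolding T using subalg_lincomb
    by (intro ring.subring_is_ring[OF ring_matrix_alg[OF finite_points]]) (simp add: subalg_def)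
  have ringS: "ring ?S" by (intro ring_direct_sum_alg ring_matrix_alg) simp
  interpret T: ring T by (rule ringT)
  interpret S: ring ?S by (rule ringS)
  have Wg: "W g \<subseteq> big_part U {1..n}" if "g \<in> {1..N}" for g
    using W that by (auto simp: bij_betw_def)
  have \<beta>_in: "\<beta> g i \<in> component (W g)" if "g \<in> {1..N}" "i \<in> {1..d g}" for g i
    using \<beta>[OF that(1)] that(2) by (rule bij_betwE[THEN bspec])
  have reg: "\<sigma> g i j \<in> regular" if "g \<in> {1..N}" "i \<in> {1..d g}" "j \<in> {1..d g}" for g i j
    unfolding \<sigma>_def using that by (intro component_idx_regular Wg \<beta>_in)
  have \<phi>_lincomb: "\<phi> (lincomb f) = (\<lambda>g\<in>{1..N}. \<lambda>i j. if i \<in> {1..d g} \<and> j \<in> {1..d g} then f (\<sigma> g i j) else 0)" for f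
    unfolding \<phi>_def by (intro restrict_ext ext) (use reg coeff_lincomb in auto)
  have entry: "\<phi> (lincomb f) g = (\<lambda>i j. if i \<in> {1..d g} \<and> j \<in> {1..d g} then f (\<sigma> g i j) else 0)"
    if "g \<in> {1..N}" for f g
    unfolding \<phi>_lincomb using that by simp
  have \<phi>_ext: "\<phi> M = (\<lambda>g\<in>{1..N}. Y g)" if "\<And>g. g \<in> {1..N} \<Longrightarrow> \<phi> M g = Y g" for M Y
    by (rule extensionalityI[of _ "{1..N}"]) (use that in \<open>simp_all add: \<phi>_def\<close>)
  have conv: "convolution f f' (\<sigma> g i j) = (\<Sum>l\<in>{1..d g}. f (\<sigma> g i l) * f' (\<sigma> g l j))"
    if g: "g \<in> {1..N}" and ij: "i \<in> {1..d g}" "j \<in> {1..d g}" for f f' g i j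
    unfolding \<sigma>_def convolution_component[OF Wg[OF g] \<beta>_in[OF g ij(1)] \<beta>_in[OF g ij(2)]]
    by (rule sum.reindex_bij_betw[OF \<beta>[OF g], symmetric])
  have \<phi>_car: "\<phi> (lincomb f) \<in> carrier ?S" for f
    by (auto simp: \<phi>_lincomb direct_sum_alg_simps matrix_alg_simps)
  \<comment> \<open>Distinct matrix positions belong to distinct indices, so coefficients can be
    prescribed freely.\<close>
  have inj: "inj_on (\<lambda>(g, i, j). \<sigma> g i j) (SIGMA g:{1..N}. {1..d g} \<times> {1..d g})"
  proof (rule inj_onI)
    fix p q assume p: "p \<in> (SIGMA g:{1..N}. {1..d g} \<times> {1..d g})"
      and q: "q \<in> (SIGMA g:{1..N}. {1..d g} \<times> {1..d g})"
      and pq: "(case p of (g, i, j) \<Rightarrow> \<sigma> g i j) = (case q of (g, i, j) \<Rightarrow> \<sigma> g i j)"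
    obtain g i j g' i' j' where pq_eq: "p = (g, i, j)" "q = (g', i', j')" by (cases p; cases q)
    have g: "g \<in> {1..N}" "g' \<in> {1..N}" and ij: "i \<in> {1..d g}" "j \<in> {1..d g}" "i' \<in> {1..d g'}" "j' \<in> {1..d g'}"
      and eq: "\<sigma> g i j = \<sigma> g' i' j'"
      using p q pq unfolding pq_eq by simp_all
    have sub: "W g \<subseteq> {1..n}" if "g \<in> {1..N}" for g using Wg[OF that] by (auto simp: big_part_def)
    have *: "W g = W g' \<and> \<beta> g i = \<beta> g' i' \<and> \<beta> g j = \<beta> g' j'"
      by (rule component_idx_inj[OF eq[unfolded \<sigma>_def]]) (use sub \<beta>_in g ij in auto)
    then have "g = g'" using W g by (auto simp: bij_betw_def dest: inj_onD)
    then show "p = q"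
      using * ij \<beta>[OF g(1)] unfolding pq_eq by (auto simp: bij_betw_def dest: inj_onD)
  qed
  have surj: "\<phi> ` carrier T = carrier ?S"
  proof (intro equalityI subsetI)
    fix Y assume "Y \<in> \<phi> ` carrier T"
    then show "Y \<in> carrier ?S" using \<phi>_car by (auto simp: T_ops(5))
  next
    fix Y assume Y: "Y \<in> carrier ?S"
    \<comment> \<open>Away from the indices \<open>\<sigma> g i j\<close> the value of
      \<open>f\<close> is arbitrary, since \<open>\<phi>\<close> does not see it.\<close>
    define f where "f t = (case inv_into (SIGMA g:{1..N}. {1..d g} \<times> {1..d g}) (\<lambda>(g, i, j). \<sigma> g i j) t of (g, i, j) \<Rightarrow> Y g i j)" for t
    have f: "f (\<sigma> g i j) = Y g i j" if "g \<in> {1..N}" "i \<in> {1..d g}" "j \<in> {1..d g}" for g i j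
      using inv_into_f_f[OF inj, of "(g, i, j)"] that by (simp add: f_def)
    have "\<phi> (lincomb f) = Y"
    proof (rule extensionalityI[of _ "{1..N}"])
      show "\<phi> (lincomb f) \<in> extensional {1..N}" by (simp add: \<phi>_def)
      show "Y \<in> extensional {1..N}" using Y by (simp add: direct_sum_alg_simps PiE_iff)
      fix g assume g: "g \<in> {1..N}"
      then have "Y g \<in> carrier (square_matrix_alg (d g))"
        using Y unfolding direct_sum_alg_simps by (rule PiE_mem[rotated])
      then show "\<phi> (lincomb f) g = Y g"
        unfolding entry[OF g] using f[OF g] by (auto simp: matrix_alg_simps fun_eq_iff)
    qed
    then show "Y \<in> \<phi> ` carrier T" by (auto simp: T_ops(5))
  qed
  have mult: "\<phi> (M \<otimes>\<^bsub>T\<^esub> M') = \<phi> M \<otimes>\<^bsub>?S\<^esub> \<phi> M'" if M: "M \<in> carrier T" "M' \<in> carrier T" for M M'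
  proof -
    obtain f f' where ff: "M = lincomb f" "M' = lincomb f'" using M unfolding T_ops(5) by blast
    show ?thesis
      unfolding ff T_ops(1) lincomb_ops(1) direct_sum_alg_simps(2)
    proof (rule \<phi>_ext)
      fix g assume g: "g \<in> {1..N}"
      show "\<phi> (lincomb (convolution f f')) g = \<phi> (lincomb f) g \<otimes>\<^bsub>square_matrix_alg (d g)\<^esub> \<phi> (lincomb f') g"
        unfolding entry[OF g] matrix_alg_simps(2)
      proof (intro ext)
        fix i j
        show "(if i \<in> {1..d g} \<and> j \<in> {1..d g} then convolution f f' (\<sigma> g i j) else 0)
          = (\<Sum>l\<in>{1..d g}. (if i \<in> {1..d g} \<and> l \<in> {1..d g} then f (\<sigma> g i l) else 0) *
              (if l \<in> {1..d g} \<and> j \<in> {1..d g} then f' (\<sigma> g l j) else 0))"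
        proof (cases "i \<in> {1..d g} \<and> j \<in> {1..d g}")
          case True
          then have ij: "i \<in> {1..d g}" "j \<in> {1..d g}" by simp_all
          have "convolution f f' (\<sigma> g i j) = (\<Sum>l\<in>{1..d g}. (if i \<in> {1..d g} \<and> l \<in> {1..d g} then f (\<sigma> g i l) else 0) *
              (if l \<in> {1..d g} \<and> j \<in> {1..d g} then f' (\<sigma> g l j) else 0))"
            unfolding conv[OF g ij] by (rule sum.cong) (use ij in simp_all)
          then show ?thesis using True by simp
        next
          case False
          then show ?thesis by (auto intro!: sum.neutral[symmetric])
        qed
      qed
    qed
  qed
  have closed: "\<phi> M \<in> carrier ?S" if "M \<in> carrier T" for M
    unfolding surj[symmetric] using that by (rule imageI)
  \<comment> \<open>A preimage \<open>r\<close> of the identity gives \<open>\<phi>\<close> of one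
    as the image of one times \<open>r\<close>, which is the identity; the expansion of the identity
    matrix is avoided.\<close>
  have one: "\<phi> \<one>\<^bsub>T\<^esub> = \<one>\<^bsub>?S\<^esub>"
  proof -
    have "\<one>\<^bsub>?S\<^esub> \<in> \<phi> ` carrier T" unfolding surj by (rule S.one_closed)
    then obtain r where r: "r \<in> carrier T" "\<phi> r = \<one>\<^bsub>?S\<^esub>" by (rule imageE) simp
    have "\<phi> \<one>\<^bsub>T\<^esub> \<in> carrier ?S" by (rule closed[OF T.one_closed])
    then have "\<phi> \<one>\<^bsub>T\<^esub> = \<phi> \<one>\<^bsub>T\<^esub> \<otimes>\<^bsub>?S\<^esub> \<phi> r" unfolding r(2) by (rule S.r_one[symmetric])
    also have "\<dots> = \<phi> r" using mult[OF T.one_closed r(1)] r by simp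
    finally show ?thesis using r by simp
  qed
  have "\<phi> \<in> ring_hom T ?S"
  proof (rule ring_hom_memI)
    fix M M' assume M: "M \<in> carrier T" "M' \<in> carrier T"
    show "\<phi> M \<in> carrier ?S" by (rule closed[OF M(1)])
    show "\<phi> (M \<otimes>\<^bsub>T\<^esub> M') = \<phi> M \<otimes>\<^bsub>?S\<^esub> \<phi> M'" by (rule mult[OF M])
    obtain f f' where ff: "M = lincomb f" "M' = lincomb f'" using M unfolding T_ops(5) by blast
    show "\<phi> (M \<oplus>\<^bsub>T\<^esub> M') = \<phi> M \<oplus>\<^bsub>?S\<^esub> \<phi> M'"
      unfolding ff T_ops(2) lincomb_ops(2) direct_sum_alg_simps(5)
      by (rule \<phi>_ext) (simp add: entry matrix_alg_simps(5) fun_eq_iff)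
  qed (rule one)
  then have hom: "ring_hom_ring T ?S \<phi>" by (rule ring_hom_ringI2[OF ringT ringS])
  have nil: "\<exists>m::nat. M [^]\<^bsub>T\<^esub> m = \<zero>\<^bsub>T\<^esub>" if M: "M \<in> carrier T" "\<phi> M = \<zero>\<^bsub>?S\<^esub>" for M
  proof -
    obtain f where f: "M = lincomb f" using M(1) unfolding T_ops(5) by blast
    have f0: "f (\<sigma> g i j) = 0" if "g \<in> {1..N}" "i \<in> {1..d g}" "j \<in> {1..d g}" for g i j
      using fun_cong[OF fun_cong[OF fun_cong[OF M(2)]], of g i j] that
      unfolding f \<phi>_lincomb by (simp add: direct_sum_alg_simps matrix_alg_simps)
    \<comment> \<open>Every index of degree zero is some \<open>\<sigma> g i j\<close>, and the
      coefficients there vanish.\<close>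
    have "min_deg 1 f"
      unfolding min_deg_def
    proof (intro ballI impI, rule ccontr)
      fix t assume t: "t \<in> indices" "f t \<noteq> 0" "\<not> 1 \<le> index_deg t"
      then have "t \<in> regular" by (simp add: regular_def)
      then obtain V a c where V: "V \<subseteq> big_part U {1..n}" "a \<in> component V" "c \<in> component V" "t = component_idx V a c"
        by (rule regular_component_idx)
      have "V \<in> W ` {1..N}" unfolding bij_betw_imp_surj_on[OF W] using V(1) by (rule PowI)
      then obtain g where g: "g \<in> {1..N}" "W g = V" by blast
      have im: "\<beta> g ` {1..d g} = component V" using \<beta>[OF g(1)] g(2) by (simp add: bij_betw_def)
      obtain i where i: "i \<in> {1..d g}" "\<beta> g i = a" using V(2) im by (metis imageE)
      obtain j where j: "j \<in> {1..d g}" "\<beta> g j = c" using V(3) im by (metis imageE)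
      have "t = \<sigma> g i j" using V(4) g i j by (simp add: \<sigma>_def)
      then show False using f0 g i j t by simp
    qed
    have "\<exists>f'. M [^]\<^bsub>T\<^esub> m = lincomb f' \<and> min_deg m f'" for m :: nat
    proof (induction m)
      case 0
      obtain f' where "\<one>\<^bsub>?M\<^esub> = lincomb f'" using one_in_lincomb by (rule imageE)
      then show ?case by (intro exI[of _ f']) (simp add: min_deg_def T_ops(3))
    next
      case (Suc m)
      then obtain f' where f': "M [^]\<^bsub>T\<^esub> m = lincomb f'" "min_deg m f'" by blast
      have "M [^]\<^bsub>T\<^esub> Suc m = lincomb (convolution f' f)"
        using f'(1) by (simp add: f T_ops(1) lincomb_ops(1))
      moreover have "min_deg (Suc m) (convolution f' f)"
        using min_deg_convolution[OF f'(2) \<open>min_deg 1 f\<close>] by simp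
      ultimately show ?case by blast
    qed
    \<comment> \<open>The exponent is one more than the largest possible degree.\<close>
    then obtain f' where "M [^]\<^bsub>T\<^esub> Suc (2 * n) = lincomb f'" "min_deg (Suc (2 * n)) f'" by blast
    then have "M [^]\<^bsub>T\<^esub> Suc (2 * n) = \<zero>\<^bsub>T\<^esub>"
      using lincomb_eq_0_if_min_deg unfolding T_ops(6) by (intro ext) metis
    then show ?thesis by blast
  qed
  have "jacobson_radical T = a_kernel T ?S \<phi>"
  proof (rule ring_hom_ring.jacobson_radical_eq_kernel[OF hom surj nil])
    show "jacobson_radical ?S \<subseteq> {\<zero>\<^bsub>?S\<^esub>}" by (rule jacobson_radical_direct_sum_matrix_alg) simp
  qed
  moreover have "alg_isomorphic (quot_alg T (a_kernel T ?S \<phi>)) ?S"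
  proof (rule alg_isomorphic_quot_kernel[OF hom surj])
    fix c M assume "M \<in> carrier T"
    then obtain f where f: "M = lincomb f" unfolding T_ops(5) by blast
    show "c \<odot>\<^bsub>T\<^esub> M \<in> carrier T" unfolding f T_ops(4,5) lincomb_ops(3) by simp
    show "\<phi> (c \<odot>\<^bsub>T\<^esub> M) = c \<odot>\<^bsub>?S\<^esub> \<phi> M"
      unfolding f T_ops(4) lincomb_ops(3) direct_sum_alg_simps(6)
      by (rule \<phi>_ext) (simp add: entry matrix_alg_simps(6) fun_eq_iff)
  qed
  ultimately show ?thesis by simp
qed

end

section \<open>The equivalence classes of triples\<close>

text \<open>The classes of the kernel relation of a map are its nonempty fibres, one for each
  value.\<close>

lemma bij_betw_image_quotient:
  fixes w :: "'a \<Rightarrow> 'b"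
  shows "bij_betw (\<lambda>y. {q \<in> D. w q = y}) (w ` D) (D // {(p, q) \<in> D \<times> D. w p = w q})"
proof -
  have class_eq: "{(p, q) \<in> D \<times> D. w p = w q} `` {p} = {q \<in> D. w q = w p}" if "p \<in> D" for p
    using that by auto
  have "inj_on (\<lambda>y. {q \<in> D. w q = y}) (w ` D)"
    by (rule inj_onI) auto
  moreover have "(\<lambda>y. {q \<in> D. w q = y}) ` (w ` D) = D // {(p, q) \<in> D \<times> D. w p = w q}"
    unfolding quotient_def image_image UNION_singleton_eq_range
    by (rule image_cong[OF refl]) (rule class_eq[symmetric])
  ultimately show ?thesis by (simp add: bij_betw_def)
qed

section \<open>The invariant of a triple and the values it takes\<close>

definition triple_invariant :: "nat \<Rightarrow> (nat \<Rightarrow> 'u set) \<Rightarrow> triple \<Rightarrow> nat set" where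
  "triple_invariant n U = (\<lambda>(a, b, c). big_part U (supp n a \<inter> supp n c) - supp n b)"

lemma D_rel_eq:
  "D_rel F n U = {(p, q) \<in> D_triples F n U \<times> D_triples F n U. triple_invariant n U p = triple_invariant n U q}"
  unfolding D_rel_def triple_invariant_def by auto

lemma supp_indicator: "V \<subseteq> {1..n} \<Longrightarrow> supp n (\<lambda>h\<in>{1..n}. if h \<in> V then 1 else 0) = V"
  by (auto simp: supp_def)

lemma indicator_binary: "(\<lambda>h\<in>{1..n}. if h \<in> V then 1 else 0) \<in> binary_tuples n"
  by (auto simp: binary_tuples_def)

lemma triple_invariant_image:
  "triple_invariant n U ` D_triples TYPE('f::field) n U = Pow (big_part U {1..n})"
proof (intro equalityI subsetI)
  fix V assume "V \<in> triple_invariant n U ` D_triples TYPE('f) n U"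
  then show "V \<in> Pow (big_part U {1..n})"
    by (auto simp: triple_invariant_def big_part_def supp_def)
next
  fix V assume "V \<in> Pow (big_part U {1..n})"
  then have V: "V \<subseteq> {1..n}" "big_part U V = V" by (auto simp: big_part_def)
  \<comment> \<open>The triple with middle entry zero realizes \<open>V\<close>; its valency is the
    empty product one, nonzero in every field.\<close>
  let ?a = "\<lambda>h\<in>{1..n}. if h \<in> V then 1 else (0::nat)" and ?b = "\<lambda>h\<in>{1..n}. if h \<in> {} then 1 else (0::nat)"
  have s: "supp n ?a = V" "supp n ?b = {}"
    using supp_indicator[OF V(1)] supp_indicator[of "{}" n] by simp_all
  have "(?a, ?b, ?a) \<in> P_triples n U"
    unfolding P_triples_def using indicator_binary[where V = V and n = n] indicator_binary[where V = "{}" and n = n] s by simp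
  then have "(?a, ?b, ?a) \<in> D_triples TYPE('f) n U"
    using s(2) by (simp add: D_triples_def valency_def)
  moreover have "V = triple_invariant n U (?a, ?b, ?a)"
    unfolding triple_invariant_def using s V(2) by simp
  ultimately show "V \<in> triple_invariant n U ` D_triples TYPE('f) n U" by (rule rev_image_eqI)
qed

text \<open>For a triple \<open>(a, b, a)\<close> the support of \<open>b\<close> must be the big
  part of the support of \<open>a\<close> without \<open>W\<close>. The valency condition thus says
  that \<open>k h\<close> is nonzero there. On small coordinates \<open>k h = 1\<close>, which
  matches the free choice in \<open>component W\<close>.\<close>

lemma (in terwilliger_coordinates) diagonal_tuples_class:
  assumes W: "W \<subseteq> big_part U {1..n}"
  shows "diagonal_tuples n {q \<in> D_triples TYPE('f) n U. triple_invariant n U q = W} = component W"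
proof -
  have val: "(of_nat (valency n U b) :: 'f) \<noteq> 0 \<longleftrightarrow> (\<forall>h\<in>supp n b. k h \<noteq> 0)" for b
  proof -
    have "(of_nat (valency n U b) :: 'f) = (\<Prod>h\<in>supp n b. k h)"
      unfolding valency_def of_nat_prod by (intro prod.cong) (auto simp: supp_def k_eq)
    moreover have "finite (supp n b)" by (simp add: supp_def)
    ultimately show ?thesis by simp
  qed
  have big: "card (U h) > 2" if "h \<in> {1..n}" "k h = 0" for h
    using k_eq_1_if_small(2)[of h] that by fastforce
  show ?thesis
  proof (intro equalityI subsetI)
    fix a assume "a \<in> diagonal_tuples n {q \<in> D_triples TYPE('f) n U. triple_invariant n U q = W}"
    then obtain b where a: "a \<in> binary_tuples n" and b: "(a, b, a) \<in> D_triples TYPE('f) n U"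
      and inv: "big_part U (supp n a) - supp n b = W"
      by (auto simp: diagonal_tuples_def triple_invariant_def)
    have bk: "\<And>h. h \<in> supp n b \<Longrightarrow> k h \<noteq> 0" using b val by (simp add: D_triples_def)
    show "a \<in> component W"
      unfolding component_def
    proof (rule PiE_I)
      fix h assume h: "h \<in> {1..n}"
      have a01: "a h = 0 \<or> a h = 1" using a h by (auto simp: binary_tuples_def)
      have "a h = 1" if "h \<in> W" using that inv by (auto simp: big_part_def supp_def)
      moreover have "a h = 0" if "h \<notin> W" "k h = 0"
      proof (rule ccontr)
        assume "a h \<noteq> 0"
        then have "h \<in> big_part U (supp n a)" using a01 h big[OF h that(2)] by (simp add: supp_def big_part_def)
        then have "h \<in> supp n b" using inv that(1) by blast
        then show False using bk that(2) by simp
      qed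
      ultimately show "a h \<in> (if h \<in> W then {1} else if k h = 0 then {0} else {0, 1})"
        using a01 by simp
    next
      fix h assume "h \<notin> {1..n}"
      then show "a h = undefined" using a unfolding binary_tuples_def by (rule PiE_arb[rotated])
    qed
  next
    fix a assume a: "a \<in> component W"
    \<comment> \<open>The only support that \<open>b\<close> can have.\<close>
    define V where "V = big_part U (supp n a) - W"
    define b :: "nat \<Rightarrow> nat" where "b = (\<lambda>h\<in>{1..n}. if h \<in> V then 1 else 0)"
    have Vn: "V \<subseteq> {1..n}" by (auto simp: V_def big_part_def supp_def)
    have bs: "supp n b = V" unfolding b_def by (rule supp_indicator[OF Vn])
    have bb: "b \<in> binary_tuples n" unfolding b_def by (rule indicator_binary)
    have ab: "a \<in> binary_tuples n"
      unfolding binary_tuples_def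
    proof (rule PiE_I)
      show "a h \<in> {0, 1}" if "h \<in> {1..n}" for h using componentD(3)[OF a that] by simp
      show "a h = undefined" if "h \<notin> {1..n}" for h
        using a that unfolding component_def by (rule PiE_arb)
    qed
    have "W \<subseteq> big_part U (supp n a)"
    proof
      fix h assume h: "h \<in> W"
      then have hn: "h \<in> {1..n}" "card (U h) > 2" using W by (auto simp: big_part_def)
      then show "h \<in> big_part U (supp n a)" using componentD(1)[OF a hn(1) h] by (simp add: supp_def big_part_def)
    qed
    then have "triple_invariant n U (a, b, a) = W" by (auto simp: triple_invariant_def bs V_def)
    moreover have "k h \<noteq> 0" if "h \<in> V" for h
      using componentD(2)[OF a, of h] that by (auto simp: V_def big_part_def supp_def)
    then have "(a, b, a) \<in> D_triples TYPE('f) n U"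
      using ab bb by (auto simp: D_triples_def P_triples_def val bs V_def)
    ultimately show "a \<in> diagonal_tuples n {q \<in> D_triples TYPE('f) n U. triple_invariant n U q = W}"
      using ab bb by (auto simp: diagonal_tuples_def)
  qed
qed

section \<open>Matching the enumerated classes with the simple components\<close>

theorem theorem8p11:
  fixes n :: nat
    and U :: "nat \<Rightarrow> 'u set"
    and x :: "nat \<Rightarrow> 'u"
    and n_sim :: nat
    and DD :: "nat \<Rightarrow> triple set"
  assumes "n \<ge> 1"
    and "\<forall>h\<in>{1..n}. finite (U h) \<and> card (U h) \<ge> 2"
    and "x \<in> points n U"
    and "bij_betw DD {1..n_sim} (D_classes TYPE('f::field) n U)"
  defines "T \<equiv> (terwilliger_alg n U x :: ('f, (nat \<Rightarrow> 'u) \<Rightarrow> (nat \<Rightarrow> 'u) \<Rightarrow> 'f) module)"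
  shows "alg_isomorphic
           (quot_alg T (jacobson_radical T))
           (direct_sum_alg {1..n_sim} (\<lambda>g. square_matrix_alg (card (diagonal_tuples n (DD g)))))"
proof -
  have ex: "\<exists>y. y \<in> U h \<and> y \<notin> S" if "h \<in> {1..n}" "finite S" "card S < card (U h)" for h S
    using that card_mono[of S "U h"] assms(2) by (meson linorder_not_less subsetI)
  have "\<exists>y. y \<in> U h \<and> y \<noteq> x h" if h: "h \<in> {1..n}" for h
    using ex[OF h, of "{x h}"] assms(2) h by fastforce
  then obtain u where u: "\<And>h. h \<in> {1..n} \<Longrightarrow> u h \<in> U h \<and> u h \<noteq> x h" by metis
  have "\<exists>y. card (U h) > 2 \<longrightarrow> y \<in> U h \<and> y \<noteq> x h \<and> y \<noteq> u h" if h: "h \<in> {1..n}" for h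
    using ex[OF h, of "{x h, u h}"] u[OF h] by auto
  then obtain v where v: "\<And>h. h \<in> {1..n} \<Longrightarrow> card (U h) > 2 \<Longrightarrow> v h \<in> U h \<and> v h \<noteq> x h \<and> v h \<noteq> u h"
    by metis
  define k :: "nat \<Rightarrow> 'f" where "k h = of_nat (card (U h) - 1)" for h
  interpret terwilliger_coordinates n U x u v k
    by unfold_locales (use assms(2,3) u v in \<open>auto simp: k_def\<close>)
  define D where "D = D_triples TYPE('f) n U"
  define cls where "cls V = {q \<in> D. triple_invariant n U q = V}" for V
  let ?B = "Pow (big_part U {1..n})"
  have cls: "bij_betw cls ?B (D_classes TYPE('f) n U)"
    unfolding D_classes_def D_rel_eq cls_def D_def triple_invariant_image[where 'f = 'f, symmetric]
    by (rule bij_betw_image_quotient)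
  \<comment> \<open>Transports the given enumeration of the classes to the subsets that are their
    invariants.\<close>
  define W where "W = inv_into ?B cls \<circ> DD"
  have W: "bij_betw W {1..n_sim} ?B"
    unfolding W_def by (rule bij_betw_trans[OF assms(4) bij_betw_inv_into[OF cls]])
  have DD: "diagonal_tuples n (DD g) = component (W g)" if g: "g \<in> {1..n_sim}" for g
  proof -
    have "DD g \<in> cls ` ?B"
      unfolding bij_betw_imp_surj_on[OF cls] by (rule bij_betwE[OF assms(4), THEN bspec, OF g])
    then have eq: "cls (W g) = DD g" unfolding W_def comp_apply by (rule f_inv_into_f)
    have "W g \<in> ?B" by (rule bij_betwE[OF W, THEN bspec, OF g])
    then show ?thesis
      unfolding eq[symmetric] cls_def D_def by (rule diagonal_tuples_class[OF PowD])
  qed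
  have "\<exists>b. bij_betw b {1..card (diagonal_tuples n (DD g))} (component (W g))" if g: "g \<in> {1..n_sim}" for g
    unfolding DD[OF g] by (rule ex_bij_betw_nat_finite_1[OF finite_component])
  then obtain \<beta> where "\<And>g. g \<in> {1..n_sim} \<Longrightarrow> bij_betw (\<beta> g) {1..card (diagonal_tuples n (DD g))} (component (W g))"
    by metis
  then show ?thesis unfolding T_def by (rule quotient_isomorphic[OF W])
qed

end
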